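(* Let $\mathcal{A}$ be a finite alphabet and $\sigma:\mathcal{A}\to\mathcal{A}^+$ a substitution. Then $\sigma$ is recognizable in $X_\sigma$ for aperiodic points, i.e., every aperiodic $y\in\mathcal{A}^{\mathbb{Z}}$ has at most one centered $\sigma$-representation in $X_\sigma$.
   Context: A substitution $\sigma:\mathcal{A}\to\mathcal{A}^+$ is given by a non-empty word $\sigma(a)\in\mathcal{A}^+$ for each letter $a$, extended by concatenation to $\mathcal{A}^*$ and $\mathcal{A}^{\mathbb{Z}}$ (with $\sigma(x_0)$ starting at index $0$ in $\sigma(x)$). No further assumption (such as primitivity) is made. $T$ is the left shift. A point $y$ is periodic if $T^k(y)=y$ for some $k\ge1$, aperiodic otherwise. The language $\mathcal{L}_\sigma$ is the set of words $w\in\mathcal{A}^*$ that are subwords (factors) of $\sigma^n(a)$ for some $a\in\mathcal{A}$, $n\in\mathbb{N}$; $X_\sigma$ is the set of $x\in\mathcal{A}^{\mathbb{Z}}$ all of whose finite subwords belong to $\mathcal{L}_\sigma$. A $\sigma$-representation of $y$ is a pair $(k,x)$ with $k\in\mathbb{Z}$, $x\in\mathcal{A}^{\mathbb{Z}}$, $y=T^k\sigma(x)$; it is centered if $0\le k<|\sigma(x_0)|$, and it is in $X_\sigma$ if $x\in X_\sigma$. *)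

theory Defs
  imports Main "HOL-Library.Sublist"
begin

text \<open>The alphabet is a finite type \<open>'a\<close>, finite words are lists over it, and bi-infinite
  sequences are functions \<open>int \<Rightarrow> 'a\<close>.\<close>

definition substitution :: "('a \<Rightarrow> 'a list) \<Rightarrow> bool" where
  "substitution \<sigma> \<longleftrightarrow> (\<forall>a. \<sigma> a \<noteq> [])"

definition subst_word :: "('a \<Rightarrow> 'a list) \<Rightarrow> 'a list \<Rightarrow> 'a list" where
  "subst_word \<sigma> w = concat (map \<sigma> w)"

text \<open>The index in \<open>\<sigma>(x)\<close> at which the block \<open>\<sigma>(x\<^sub>n)\<close> starts; block 0 starts at index 0.\<close>

definition block_start :: "('a \<Rightarrow> 'a list) \<Rightarrow> (int \<Rightarrow> 'a) \<Rightarrow> int \<Rightarrow> int" where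
  "block_start \<sigma> x n =
     (if 0 \<le> n then (\<Sum>i\<in>{0..<n}. int (length (\<sigma> (x i))))
      else - (\<Sum>i\<in>{n..<0}. int (length (\<sigma> (x i)))))"

text \<open>The index \<open>n\<close> below is the unique one whose block covers position \<open>j\<close>; see
  \<open>ex1_block\<close> and \<open>subst_seq_block\<close> for existence, uniqueness and the resulting
  characterization.\<close>

definition subst_seq :: "('a \<Rightarrow> 'a list) \<Rightarrow> (int \<Rightarrow> 'a) \<Rightarrow> (int \<Rightarrow> 'a)" where
  "subst_seq \<sigma> x = (\<lambda>j.
     let n = (THE n. block_start \<sigma> x n \<le> j \<and> j < block_start \<sigma> x (n + 1))
     in \<sigma> (x n) ! nat (j - block_start \<sigma> x n))"

text \<open>\<open>shift k\<close> is the \<open>k\<close>-th power of the left shift, for any integer \<open>k\<close>.\<close>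

definition shift :: "int \<Rightarrow> (int \<Rightarrow> 'a) \<Rightarrow> (int \<Rightarrow> 'a)" where
  "shift k x = (\<lambda>n. x (n + k))"

definition periodic :: "(int \<Rightarrow> 'a) \<Rightarrow> bool" where
  "periodic y \<longleftrightarrow> (\<exists>k\<ge>1. shift k y = y)"

abbreviation aperiodic :: "(int \<Rightarrow> 'a) \<Rightarrow> bool" where
  "aperiodic y \<equiv> \<not> periodic y"

definition language :: "('a \<Rightarrow> 'a list) \<Rightarrow> 'a list set" where
  "language \<sigma> = {w. \<exists>a n. sublist w ((subst_word \<sigma> ^^ n) [a])}"

definition subst_shift_space :: "('a \<Rightarrow> 'a list) \<Rightarrow> (int \<Rightarrow> 'a) set" where
  "subst_shift_space \<sigma> = {x. \<forall>i j. map x [i..j] \<in> language \<sigma>}"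

definition representation :: "('a \<Rightarrow> 'a list) \<Rightarrow> (int \<Rightarrow> 'a) \<Rightarrow> int \<times> (int \<Rightarrow> 'a) \<Rightarrow> bool" where
  "representation \<sigma> y = (\<lambda>(k, x). y = shift k (subst_seq \<sigma> x))"

definition centered :: "('a \<Rightarrow> 'a list) \<Rightarrow> int \<times> (int \<Rightarrow> 'a) \<Rightarrow> bool" where
  "centered \<sigma> = (\<lambda>(k, x). 0 \<le> k \<and> k < int (length (\<sigma> (x 0))))"

definition recognizable_aperiodic :: "('a \<Rightarrow> 'a list) \<Rightarrow> (int \<Rightarrow> 'a) set \<Rightarrow> bool" where
  "recognizable_aperiodic \<sigma> X \<longleftrightarrow>
     (\<forall>y. aperiodic y \<longrightarrow>
        (\<exists>\<^sub>\<le>\<^sub>1 r. representation \<sigma> y r \<and> centered \<sigma> r \<and> snd r \<in> X))"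

lemma shift_funpow: "(shift 1 ^^ n) x = shift (int n) x"
  by (induction n) (auto simp: shift_def algebra_simps)

lemma block_start_0 [simp]: "block_start \<sigma> x 0 = 0"
  by (simp add: block_start_def)

lemma block_start_Suc:
  "block_start \<sigma> x (n + 1) = block_start \<sigma> x n + int (length (\<sigma> (x n)))"
proof (cases "0 \<le> n")
  case True
  then have "{0..<n + 1} = insert n {0..<n}" by auto
  with True show ?thesis by (simp add: block_start_def)
next
  case False
  then have "{n..<0} = insert n {n + 1..<0}" by auto
  with False show ?thesis by (cases "n = -1") (simp_all add: block_start_def)
qed

lemma block_start_mono:
  assumes "substitution \<sigma>" "m \<le> n"
  shows "n - m \<le> block_start \<sigma> x n - block_start \<sigma> x m"
  using assms(2)
proof (induction n rule: int_ge_induct)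
  case base
  then show ?case by simp
next
  case (step n)
  have "length (\<sigma> (x n)) \<ge> 1"
    using assms(1) by (simp add: substitution_def Suc_le_eq)
  with step show ?case by (simp add: block_start_Suc)
qed

lemma ex1_block:
  assumes "substitution \<sigma>"
  shows "\<exists>!n. block_start \<sigma> x n \<le> j \<and> j < block_start \<sigma> x (n + 1)"
proof (rule ex_ex1I)
  let ?b = "block_start \<sigma> x"
  have lo: "?b (- \<bar>j\<bar>) \<le> j"
    using block_start_mono[OF assms, of "- \<bar>j\<bar>" 0 x] by simp
  have up: "j < ?b n" if "n \<ge> \<bar>j\<bar> + 1" for n
    using block_start_mono[OF assms, of 0 n x] that by (simp; linarith)
  show "\<exists>n. ?b n \<le> j \<and> j < ?b (n + 1)"
  proof (rule ccontr)
    assume no: "\<not> ?thesis"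
    have "?b n \<le> j" if "n \<ge> - \<bar>j\<bar>" for n
      using that by (induction n rule: int_ge_induct) (use lo no in \<open>auto simp: not_less\<close>)
    from this[of "\<bar>j\<bar> + 1"] show False using up[of "\<bar>j\<bar> + 1"] by simp
  qed
next
  fix m n
  let ?b = "block_start \<sigma> x"
  assume *: "?b m \<le> j \<and> j < ?b (m + 1)" "?b n \<le> j \<and> j < ?b (n + 1)"
  show "m = n"
  proof (rule linorder_cases[of m n])
    assume "m < n"
    then show ?thesis using * block_start_mono[OF assms, of "m + 1" n x] by simp
  next
    assume "n < m"
    then show ?thesis using * block_start_mono[OF assms, of "n + 1" m x] by simp
  qed
qed

lemma subst_seq_block:
  assumes "substitution \<sigma>" "i < length (\<sigma> (x n))"
  shows "subst_seq \<sigma> x (block_start \<sigma> x n + int i) = \<sigma> (x n) ! i"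
proof -
  have "(THE m. block_start \<sigma> x m \<le> block_start \<sigma> x n + int i \<and>
                block_start \<sigma> x n + int i < block_start \<sigma> x (m + 1)) = n"
    by (rule the1_equality[OF ex1_block[OF assms(1)]])
       (use assms(2) in \<open>simp add: block_start_Suc\<close>)
  then show ?thesis by (simp add: subst_seq_def)
qed

end

theory Submission
  imports Defs "HOL-Library.Infinite_Set"
begin

text \<open>Call \<open>\<sigma>\<close> elementary if it does not factor through a smaller alphabet.

  Suppose first that \<open>\<sigma>\<close> is elementary and that \<open>\<sigma>(x')\<close> is a shift of \<open>\<sigma>(x)\<close>. Split each
  word \<open>\<sigma>(a)\<close> into non-empty words such that the two factorizations of \<open>\<sigma>(x)\<close> into these pieces
  agree, with as few pieces as possible. If some piece never occurs at the beginning of a \<open>\<sigma>(a)\<close>, it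
  can be glued to its predecessor; so every piece begins (and likewise ends) some \<open>\<sigma>(a)\<close>. As \<open>\<sigma>\<close> is
  elementary, there are as many pieces as letters, hence the first piece and the last piece of
  \<open>\<sigma>(a)\<close> each determine \<open>a\<close>. Thus two factorizations with a common cut are equal, and two without
  common cut evolve deterministically through finitely many states, so that \<open>\<sigma>(x)\<close> is periodic.

  If \<open>\<sigma> = \<alpha> \<circ> \<beta>\<close> with an intermediate alphabet of smaller size, then recognizability of
  \<open>\<sigma>\<close> follows from that of \<open>\<beta> \<circ> \<alpha>\<close>, because all points under consideration can be
  desubstituted again and again. To stay among aperiodic points, one also needs that a
  desubstitutable \<open>x\<close> with \<open>\<sigma>(x)\<close> periodic is itself periodic, which is proved by the
  same induction on the size of the alphabet.\<close>

section \<open>Concatenation of bi-infinite sequences of words\<close>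

lemma shift_apply: "shift k x n = x (n + k)"
  by (simp add: shift_def)

lemma shift_0 [simp]: "shift 0 x = x"
  by (simp add: shift_def)

lemma shift_shift [simp]: "shift k (shift l x) = shift (k + l) x"
  by (rule ext) (simp add: shift_def algebra_simps)

lemma comp_shift: "f \<circ> shift k x = shift k (f \<circ> x)"
  by (simp add: shift_def fun_eq_iff)

lemma range_shift [simp]: "range (shift k x) = range x"
proof -
  have "range (shift k x) \<subseteq> range x" for k and x :: "int \<Rightarrow> 'a"
    by (auto simp: shift_def)
  from this[of k x] this[of "- k" "shift k x"] show ?thesis by auto
qed

lemma periodic_shift_imp: "periodic x \<Longrightarrow> periodic (shift m x)"
  unfolding periodic_def by (metis add.commute shift_shift)

lemma periodic_shift [simp]: "periodic (shift m x) \<longleftrightarrow> periodic x"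
  using periodic_shift_imp[of x m] periodic_shift_imp[of "shift m x" "- m"] by auto

lemma int_fun_eqI:
  fixes f g :: "int \<Rightarrow> int"
  assumes "f 0 = g 0" "\<And>n. f (n + 1) - f n = g (n + 1) - g n"
  shows "f n = g n"
proof (induction n rule: int_induct[where k = 0])
  case base
  show ?case by (fact assms(1))
next
  case (step1 i)
  then show ?case using assms(2)[of i] by simp
next
  case (step2 i)
  then show ?case using assms(2)[of "i - 1"] by simp
qed

text \<open>Writing \<open>\<sigma>(x)\<close> as \<open>cat (\<sigma> \<circ> x)\<close> allows morphisms between different alphabets, unlike
  \<open>subst_seq\<close>.\<close>

definition start :: "(int \<Rightarrow> 'b list) \<Rightarrow> int \<Rightarrow> int" where
  "start w n =
     (if 0 \<le> n then (\<Sum>i\<in>{0..<n}. int (length (w i)))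
      else - (\<Sum>i\<in>{n..<0}. int (length (w i))))"

definition cat :: "(int \<Rightarrow> 'b list) \<Rightarrow> int \<Rightarrow> 'b" where
  "cat w j = (let n = (THE n. start w n \<le> j \<and> j < start w (n + 1)) in w n ! nat (j - start w n))"

definition nonempty :: "(int \<Rightarrow> 'b list) \<Rightarrow> bool" where
  "nonempty w \<longleftrightarrow> (\<forall>n. w n \<noteq> [])"

lemma nonempty_shift [simp]: "nonempty (shift k w) \<longleftrightarrow> nonempty w"
  unfolding nonempty_def shift_def by (metis diff_add_cancel)

lemma block_start_eq_start: "block_start \<sigma> x = start (\<sigma> \<circ> x)"
  by (simp add: block_start_def start_def fun_eq_iff)

lemma subst_seq_eq_cat: "subst_seq \<sigma> x = cat (\<sigma> \<circ> x)"
  by (simp add: subst_seq_def cat_def block_start_eq_start fun_eq_iff)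

lemma start_0 [simp]: "start w 0 = 0"
  by (simp add: start_def)

lemma start_Suc: "start w (n + 1) = start w n + int (length (w n))"
proof (cases "0 \<le> n")
  case True
  then have "{0..<n + 1} = insert n {0..<n}" by auto
  with True show ?thesis by (simp add: start_def)
next
  case False
  then have "{n..<0} = insert n {n + 1..<0}" by auto
  with False show ?thesis by (cases "n = -1") (simp_all add: start_def)
qed

lemma start_mono:
  assumes "nonempty w" "m \<le> n"
  shows "n - m \<le> start w n - start w m"
  using assms(2)
proof (induction n rule: int_ge_induct)
  case (step n)
  have "length (w n) \<ge> 1"
    using assms(1) by (simp add: nonempty_def Suc_le_eq)
  with step show ?case by (simp add: start_Suc)
qed simp

lemma start_less_iff:
  assumes "nonempty w"
  shows "start w m < start w n \<longleftrightarrow> m < n"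
  using start_mono[OF assms, of m n] start_mono[OF assms, of n m] by linarith

lemma start_eq_iff:
  assumes "nonempty w"
  shows "start w m = start w n \<longleftrightarrow> m = n"
  using start_less_iff[OF assms, of m n] start_less_iff[OF assms, of n m] by linarith

lemma start_cover:
  assumes "nonempty w"
  shows "\<exists>n. start w n \<le> j \<and> j < start w (n + 1)"
proof (rule ccontr)
  assume no: "\<not> ?thesis"
  have lower: "start w (- \<bar>j\<bar>) \<le> j"
    using start_mono[OF assms, of "- \<bar>j\<bar>" 0] by simp
  have "start w n \<le> j" if "- \<bar>j\<bar> \<le> n" for n
    using that
  proof (induction n rule: int_ge_induct)
    case (step n)
    then show ?case using no by (auto simp: not_less)
  qed (fact lower)
  from this[of "\<bar>j\<bar> + 1"] show False
    using start_mono[OF assms, of 0 "\<bar>j\<bar> + 1"] by simp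
qed

lemma start_between:
  assumes "nonempty w" "start w m \<le> j" "j < start w (m + 1)" "start w n \<le> j" "j < start w (n + 1)"
  shows "m = n"
proof -
  have "start w m < start w (n + 1)" "start w n < start w (m + 1)" using assms(2-5) by auto
  then show ?thesis using start_less_iff[OF assms(1)] by fastforce
qed

lemma block_cases:
  assumes "nonempty w"
  obtains n i where "j = start w n + int i" "i < length (w n)"
proof -
  obtain n where n: "start w n \<le> j" "j < start w (n + 1)"
    using start_cover[OF assms] by blast
  then have "j = start w n + int (nat (j - start w n))" "nat (j - start w n) < length (w n)"
    by (auto simp: start_Suc)
  then show ?thesis by (rule that)
qed

lemma cat_block:
  assumes "nonempty w" "i < length (w n)"
  shows "cat w (start w n + int i) = w n ! i"
proof -
  have "(THE m. start w m \<le> start w n + int i \<and> start w n + int i < start w (m + 1)) = n"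
  proof (rule the_equality)
    show "start w n \<le> start w n + int i \<and> start w n + int i < start w (n + 1)"
      using assms(2) by (simp add: start_Suc)
    then show "m = n" if "start w m \<le> start w n + int i \<and> start w n + int i < start w (m + 1)" for m
      using start_between[OF assms(1)] that by blast
  qed
  then show ?thesis by (simp add: cat_def)
qed

lemma cat_eqI:
  assumes "nonempty w" "\<And>n i. i < length (w n) \<Longrightarrow> y (start w n + int i) = w n ! i"
  shows "cat w = y"
proof
  fix j
  obtain n i where "j = start w n + int i" "i < length (w n)"
    using block_cases[OF assms(1)] .
  then show "cat w j = y j"
    using cat_block[OF assms(1)] assms(2) by simp
qed

lemma start_shift: "start (shift m w) n = start w (n + m) - start w m"
proof (rule int_fun_eqI[where f = "start (shift m w)" and g = "\<lambda>n. start w (n + m) - start w m"])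
  fix n
  have "n + 1 + m = (n + m) + 1" by simp
  then show "start (shift m w) (n + 1) - start (shift m w) n =
    start w (n + 1 + m) - start w m - (start w (n + m) - start w m)"
    by (simp only: start_Suc shift_apply)
qed simp

lemma cat_shift:
  assumes "nonempty w"
  shows "cat (shift m w) = shift (start w m) (cat w)"
proof (rule cat_eqI)
  show "nonempty (shift m w)" using assms by simp
next
  fix n i
  assume "i < length (shift m w n)"
  then show "shift (start w m) (cat w) (start (shift m w) n + int i) = shift m w n ! i"
    using cat_block[OF assms, of i "n + m"]
    by (simp add: shift_apply start_shift algebra_simps)
qed

lemma periodic_cat:
  assumes "nonempty w" "periodic w"
  shows "periodic (cat w)"
proof -
  obtain k where k: "k \<ge> 1" "shift k w = w" using assms(2) by (auto simp: periodic_def)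
  have "shift (start w k) (cat w) = cat w"
    using cat_shift[OF assms(1), of k] k(2) by simp
  moreover have "start w k \<ge> 1"
    using start_mono[OF assms(1), of 0 k] k(1) by simp
  ultimately show ?thesis unfolding periodic_def by blast
qed

lemma periodic_comp: "periodic x \<Longrightarrow> periodic (f \<circ> x)"
  unfolding periodic_def by (metis comp_shift)

lemma range_cat:
  assumes "nonempty w" "\<And>n. set (w n) \<subseteq> S"
  shows "range (cat w) \<subseteq> S"
proof
  fix c
  assume "c \<in> range (cat w)"
  then obtain j where j: "c = cat w j" by blast
  obtain n i where "j = start w n + int i" "i < length (w n)"
    using block_cases[OF assms(1)] .
  then show "c \<in> S"
    using cat_block[OF assms(1)] assms(2)[of n] j by (metis nth_mem subsetD)
qed

text \<open>Induction on \<open>v\<close> with \<open>p\<close> free: the head of \<open>v\<close>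
  fills exactly one block of \<open>\<alpha> \<circ> y\<close>, and the tail is the same situation
  at \<open>p + 1\<close>. Applied to single blocks, this yields the composition law
  \<open>cat_concat\<close>.\<close>

lemma cat_factor:
  assumes "nonempty (\<alpha> \<circ> y)" "\<And>i. i < length v \<Longrightarrow> y (p + int i) = v ! i"
  shows "start (\<alpha> \<circ> y) (p + int (length v)) = start (\<alpha> \<circ> y) p + int (length (concat (map \<alpha> v)))"
    and "i < length (concat (map \<alpha> v)) \<Longrightarrow>
      cat (\<alpha> \<circ> y) (start (\<alpha> \<circ> y) p + int i) = concat (map \<alpha> v) ! i"
  using assms(2) unfolding comp_def
proof (induction v arbitrary: p i)
  case Nil
  { case 1 then show ?case by simp next case 2 then show ?case by simp }
next
  case (Cons a v)
  have hd: "y p = a" if "\<And>i. i < length (a # v) \<Longrightarrow> y (p + int i) = (a # v) ! i" for p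
    using that[of 0] by simp
  have tl: "y (p + 1 + int i) = v ! i"
    if "\<And>i. i < length (a # v) \<Longrightarrow> y (p + int i) = (a # v) ! i" "i < length v" for p i
    using that(1)[of "Suc i"] that(2) by (simp add: algebra_simps)
  {
    case 1
    then show ?case
      using Cons.IH(1)[of "p + 1", OF tl[OF 1]] hd[OF 1] start_Suc[of "\<lambda>n. \<alpha> (y n)" p]
      by (simp add: algebra_simps)
  next
    case 2
    show ?case
    proof (cases "i < length (\<alpha> a)")
      case True
      then show ?thesis
        using cat_block[OF assms(1), of i p] hd[OF 2(2)] by (simp add: nth_append comp_def)
    next
      case False
      then have "i - length (\<alpha> a) < length (concat (map \<alpha> v))" using 2(1) by auto
      from Cons.IH(2)[OF this, of "p + 1", OF tl[OF 2(2)]] False hd[OF 2(2)]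
      show ?thesis by (simp add: start_Suc nth_append of_nat_diff)
    qed
  }
qed

text \<open>For \<open>w = \<beta> \<circ> x\<close> this is the composition of two morphisms,
  tracked on letters and on cuts. With \<open>\<alpha> = id\<close> it flattens a sequence of words
  of words.\<close>

lemma cat_concat:
  assumes "nonempty w" "nonempty (\<alpha> \<circ> cat w)"
  shows start_cat: "start (\<lambda>n. concat (map \<alpha> (w n))) n = start (\<alpha> \<circ> cat w) (start w n)"
    and cat_cat: "cat (\<lambda>n. concat (map \<alpha> (w n))) = cat (\<alpha> \<circ> cat w)"
proof -
  note f = cat_factor[of \<alpha> "cat w" "w n" "start w n" for n, OF assms(2) cat_block[OF assms(1)]]
  show *: "start (\<lambda>n. concat (map \<alpha> (w n))) n = start (\<alpha> \<circ> cat w) (start w n)" for n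
    by (rule int_fun_eqI[where f = "start (\<lambda>n. concat (map \<alpha> (w n)))"
          and g = "\<lambda>n. start (\<alpha> \<circ> cat w) (start w n)"]) (simp_all add: start_Suc f(1))
  \<comment> \<open>\<open>\<alpha>\<close> is known to be non-empty only on letters of
    \<open>cat w\<close>, so non-emptiness is read off the strictly increasing cuts.\<close>
  have nonempty: "nonempty (\<lambda>n. concat (map \<alpha> (w n)))"
    unfolding nonempty_def
  proof
    fix n
    have "start (\<alpha> \<circ> cat w) (start w n) < start (\<alpha> \<circ> cat w) (start w (n + 1))"
      using start_less_iff[OF assms(2)] start_less_iff[OF assms(1)] by simp
    then have "start (\<lambda>n. concat (map \<alpha> (w n))) n < start (\<lambda>n. concat (map \<alpha> (w n))) (n + 1)"
      unfolding * .
    then show "concat (map \<alpha> (w n)) \<noteq> []" unfolding start_Suc by (metis add_0_right less_irrefl list.size(3) of_nat_0)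
  qed
  show "cat (\<lambda>n. concat (map \<alpha> (w n))) = cat (\<alpha> \<circ> cat w)"
  proof (rule cat_eqI[OF nonempty])
    fix n i
    assume "i < length (concat (map \<alpha> (w n)))"
    then show "cat (\<alpha> \<circ> cat w) (start (\<lambda>n. concat (map \<alpha> (w n))) n + int i) = concat (map \<alpha> (w n)) ! i"
      unfolding * by (intro f(2))
  qed
qed

lemma cat_map:
  assumes "nonempty w"
  shows "cat (\<lambda>n. map f (w n)) = f \<circ> cat w"
proof (rule cat_eqI)
  fix n i
  assume "i < length (map f (w n))"
  moreover have "start (\<lambda>n. map f (w n)) n = start w n"
    by (simp add: start_def)
  ultimately show "(f \<circ> cat w) (start (\<lambda>n. map f (w n)) n + int i) = map f (w n) ! i"
    using cat_block[OF assms, of i n] by simp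
qed (use assms in \<open>simp add: nonempty_def\<close>)

section \<open>Comparing two factorizations\<close>

text \<open>Both factorizations have the cut 0 at index 0. The first assumption carries a common cut
  of equal index one block to the right, the second one block to the left.\<close>

lemma synchronized_eq:
  assumes "\<And>n. start (\<sigma> \<circ> u) n = start (\<sigma> \<circ> v) n \<Longrightarrow> u n = v n"
    and "\<And>n. start (\<sigma> \<circ> u) n = start (\<sigma> \<circ> v) n \<Longrightarrow> u (n - 1) = v (n - 1)"
  shows "u = v"
proof
  fix n
  have "start (\<sigma> \<circ> u) n = start (\<sigma> \<circ> v) n"
    unfolding comp_def
  proof (induction n rule: int_induct[where k = 0])
    case (step1 i)
    then show ?case using assms(1)[of i] by (simp add: start_Suc comp_def)
  next
    case (step2 i)
    then show ?case
      using assms(2)[of i] start_Suc[of "\<lambda>n. \<sigma> (u n)" "i - 1"] start_Suc[of "\<lambda>n. \<sigma> (v n)" "i - 1"]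
      by (simp add: comp_def)
  qed simp
  then show "u n = v n" by (rule assms(1))
qed

text \<open>From a common cut, both blocks end at the next element of the same set of cuts, so they
  have the same length and hence the same letters. \<open>len\<close> gives one inequality and is
  used in both directions.\<close>

lemma eq_if_same_cuts:
  assumes u: "nonempty u" and v: "nonempty v"
    and eq: "cat u = cat v" and cuts: "range (start u) = range (start v)"
  shows "u = v"
proof -
  have len: "length (u n) \<le> length (v p)"
    if b: "start u n = start v p" and r: "range (start u) = range (start v)"
      and u: "nonempty u" and v: "nonempty v"
    for n p and u v :: "int \<Rightarrow> 'a list"
  proof -
    obtain q where q: "start v (p + 1) = start u q"
      using r by (metis rangeE rangeI)
    then have "start u n < start u q"
      using b start_less_iff[OF v, of p "p + 1"] by simp
    then have "start u (n + 1) \<le> start u q"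
      using start_less_iff[OF u, of n q] start_less_iff[OF u, of q "n + 1"]
      by linarith
    then show ?thesis using q b by (simp add: start_Suc)
  qed
  have letter: "u n = v p" if b: "start u n = start v p" for n p
  proof (rule nth_equalityI)
    show l: "length (u n) = length (v p)"
      using len[OF b cuts u v] len[OF b[symmetric] cuts[symmetric] v u] by simp
    fix i assume "i < length (u n)"
    then show "u n ! i = v p ! i"
      using cat_block[OF u, of i n] cat_block[OF v, of i p] l b eq by simp
  qed
  show ?thesis
  proof (rule synchronized_eq[where \<sigma> = "\<lambda>w. w"]; unfold comp_def)
    fix n
    assume b: "start (\<lambda>n. u n) n = start (\<lambda>n. v n) n"
    then show "u n = v n" by (rule letter)
    \<comment> \<open>The cut before block \<open>n\<close> is also a cut of \<open>v\<close>; that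
      its index there is \<open>n - 1\<close> follows only after the blocks are compared.\<close>
    obtain p where p: "start u (n - 1) = start v p"
      using cuts by (metis rangeE rangeI)
    have "u (n - 1) = v p" by (rule letter[OF p])
    moreover have "start u n = start u (n - 1) + int (length (u (n - 1)))"
      using start_Suc[of u "n - 1"] by simp
    ultimately have "start v n = start v (p + 1)"
      using b p by (simp add: start_Suc)
    then have "p = n - 1" using start_eq_iff[OF v] by fastforce
    with \<open>u (n - 1) = v p\<close> show "u (n - 1) = v (n - 1)" by simp
  qed
qed

section \<open>Morphisms whose images have distinct first letters and distinct last letters\<close>

text \<open>Among the \<open>?N + 1\<close> positions up to \<open>t\<close> some state repeats, and
  determinism propagates this to a period \<open>e \<le> ?N\<close> valid from there on. As
  \<open>e\<close> may vary with \<open>t\<close>, the common multiple \<open>fact ?N\<close> serves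
  as the global period.\<close>

lemma deterministic_periodic:
  fixes W :: "int \<Rightarrow> 's"
  assumes fin: "finite (range W)" and step: "\<And>s t. W s = W t \<Longrightarrow> W (s + 1) = W (t + 1)"
  shows "periodic W"
  unfolding periodic_def
proof (intro exI conjI ext)
  let ?N = "card (range W)"
  show "(1 :: int) \<le> fact ?N" by (rule fact_ge_1)
  fix t
  have "\<not> inj_on W {t - int ?N..t}"
  proof
    assume "inj_on W {t - int ?N..t}"
    then have "card {t - int ?N..t} \<le> ?N"
      by (rule card_inj_on_le) (use fin in auto)
    then show False by simp
  qed
  then obtain s s' where s: "t - int ?N \<le> s" "s < s'" "s' \<le> t" "W s = W s'"
    unfolding inj_on_def by (metis atLeastAtMost_iff linorder_less_linear)
  define e where "e = nat (s' - s)"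
  have e: "1 \<le> e" "e \<le> ?N" "s' = s + int e" using s by (auto simp: e_def)
  have shift: "W r = W (r + int e)" if "s \<le> r" for r
    using that
  proof (induction r rule: int_ge_induct)
    case base
    then show ?case using s(4) e(3) by simp
  next
    case (step i)
    then show ?case using assms(2)[of i "i + int e"] by (simp add: algebra_simps)
  qed
  have multiple: "W r = W (r + int e * int q)" if "s \<le> r" for r q
  proof (induction q)
    case (Suc q)
    have "s \<le> r + int e * int q" using that by (simp add: add_increasing2)
    from shift[OF this] Suc show ?case by (simp add: algebra_simps)
  qed simp
  have "e dvd fact ?N" using e by (intro dvd_fact)
  then obtain q where "fact ?N = e * q" by (rule dvdE)
  then have "(fact ?N :: int) = int e * int q" by (metis of_nat_fact of_nat_mult)
  then show "shift (fact ?N) W t = W t" using multiple[of t q] s by (simp add: shift_apply)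
qed

section \<open>Cells of a factorization and their evolution\<close>

text \<open>The block index is dropped so that only finitely many cells occur over a finite
  alphabet; letter and offset still determine the symbol of \<open>cat (\<sigma> \<circ> x)\<close>
  at \<open>t\<close>.\<close>

definition cell :: "('a \<Rightarrow> 'b list) \<Rightarrow> (int \<Rightarrow> 'a) \<Rightarrow> int \<Rightarrow> 'a \<times> nat" where
  "cell \<sigma> x t = (let n = (THE n. start (\<sigma> \<circ> x) n \<le> t \<and> t < start (\<sigma> \<circ> x) (n + 1))
     in (x n, nat (t - start (\<sigma> \<circ> x) n)))"

lemma cell_block:
  assumes "nonempty (\<sigma> \<circ> x)" "i < length (\<sigma> (x n))"
  shows "cell \<sigma> x (start (\<sigma> \<circ> x) n + int i) = (x n, i)"
proof -
  let ?t = "start (\<sigma> \<circ> x) n + int i"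
  have "(THE m. start (\<sigma> \<circ> x) m \<le> ?t \<and> ?t < start (\<sigma> \<circ> x) (m + 1)) = n"
  proof (rule the_equality)
    show "start (\<sigma> \<circ> x) n \<le> ?t \<and> ?t < start (\<sigma> \<circ> x) (n + 1)"
      using assms(2) by (simp add: start_Suc)
    then show "m = n" if "start (\<sigma> \<circ> x) m \<le> ?t \<and> ?t < start (\<sigma> \<circ> x) (m + 1)" for m
      using start_between[OF assms(1)] that by blast
  qed
  then show ?thesis by (simp add: cell_def)
qed

lemma cell_facts:
  assumes "nonempty (\<sigma> \<circ> x)" "cell \<sigma> x t = (a, i)"
  shows "a \<in> range x" "i < length (\<sigma> a)" "cat (\<sigma> \<circ> x) t = \<sigma> a ! i"
    and cell_inner: "Suc i < length (\<sigma> a) \<Longrightarrow> cell \<sigma> x (t + 1) = (a, Suc i)"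
    and cell_boundary: "\<not> Suc i < length (\<sigma> a) \<Longrightarrow> t + 1 \<in> range (start (\<sigma> \<circ> x)) \<and>
      (\<exists>b\<in>range x. cell \<sigma> x (t + 1) = (b, 0) \<and> cat (\<sigma> \<circ> x) (t + 1) = hd (\<sigma> b))"
proof -
  obtain n j where nj: "t = start (\<sigma> \<circ> x) n + int j" "j < length ((\<sigma> \<circ> x) n)"
    using block_cases[OF assms(1)] .
  then have [simp]: "x n = a" "j = i" using cell_block[OF assms(1), of j n] assms(2) by auto
  show "a \<in> range x" using \<open>x n = a\<close> by blast
  show "i < length (\<sigma> a)" using nj by simp
  show "cat (\<sigma> \<circ> x) t = \<sigma> a ! i" using cat_block[OF assms(1), of i n] nj by simp
  show "cell \<sigma> x (t + 1) = (a, Suc i)" if "Suc i < length (\<sigma> a)"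
    using cell_block[OF assms(1), of "Suc i" n] that nj by (simp add: algebra_simps)
  assume "\<not> Suc i < length (\<sigma> a)"
  then have t: "t + 1 = start (\<sigma> \<circ> x) (n + 1)" using nj by (simp add: start_Suc)
  have ne: "\<sigma> (x (n + 1)) \<noteq> []" using assms(1) by (simp add: nonempty_def)
  have "cell \<sigma> x (t + 1) = (x (n + 1), 0)"
    using cell_block[OF assms(1), of 0 "n + 1"] t ne by simp
  moreover have "cat (\<sigma> \<circ> x) (t + 1) = hd (\<sigma> (x (n + 1)))"
    using cat_block[OF assms(1), of 0 "n + 1"] t ne by (simp add: hd_conv_nth)
  ultimately show "t + 1 \<in> range (start (\<sigma> \<circ> x)) \<and>
      (\<exists>b\<in>range x. cell \<sigma> x (t + 1) = (b, 0) \<and> cat (\<sigma> \<circ> x) (t + 1) = hd (\<sigma> b))"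
    using t by blast
qed

lemma finite_range_cell:
  assumes "nonempty (\<sigma> \<circ> x)" "finite (range x)"
  shows "finite (range (cell \<sigma> x))"
proof (rule finite_subset)
  show "range (cell \<sigma> x) \<subseteq> (SIGMA a:range x. {..<length (\<sigma> a)})"
  proof
    fix c assume "c \<in> range (cell \<sigma> x)"
    then obtain t where "cell \<sigma> x t = (fst c, snd c)" by auto
    from cell_facts(1,2)[OF assms(1) this] show "c \<in> (SIGMA a:range x. {..<length (\<sigma> a)})"
      by (cases c) auto
  qed
  show "finite (SIGMA a:range x. {..<length (\<sigma> a)})" using assms(2) by blast
qed

text \<open>Inside a block the offset just grows. At the end of a block the next symbol is the head
  of the next block, and distinct heads identify that block.\<close>

lemma cell_deterministic:
  assumes "nonempty (\<sigma> \<circ> x)" "inj_on (hd \<circ> \<sigma>) (range x)"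
    and eq: "cell \<sigma> x s = cell \<sigma> x t" "cat (\<sigma> \<circ> x) (s + 1) = cat (\<sigma> \<circ> x) (t + 1)"
  shows "cell \<sigma> x (s + 1) = cell \<sigma> x (t + 1)"
proof -
  obtain a i where t: "cell \<sigma> x t = (a, i)" by fastforce
  with eq have s: "cell \<sigma> x s = (a, i)" by simp
  show ?thesis
  proof (cases "Suc i < length (\<sigma> a)")
    case True
    then show ?thesis using cell_inner[OF assms(1) t] cell_inner[OF assms(1) s] by simp
  next
    case False
    obtain b where b: "b \<in> range x" "cell \<sigma> x (s + 1) = (b, 0)" "cat (\<sigma> \<circ> x) (s + 1) = hd (\<sigma> b)"
      using cell_boundary[OF assms(1) s False] by blast
    obtain c where c: "c \<in> range x" "cell \<sigma> x (t + 1) = (c, 0)" "cat (\<sigma> \<circ> x) (t + 1) = hd (\<sigma> c)"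
      using cell_boundary[OF assms(1) t False] by blast
    have "b = c" by (rule inj_onD[OF assms(2) _ b(1) c(1)]) (use b c eq(2) in simp)
    then show ?thesis using b c by simp
  qed
qed

text \<open>If the current block continues, the cell alone predicts the next symbol.\<close>

lemma cat_Suc_eq_if_no_cut:
  assumes "nonempty (\<sigma> \<circ> x)" "cell \<sigma> x s = cell \<sigma> x t" "t + 1 \<notin> range (start (\<sigma> \<circ> x))"
  shows "cat (\<sigma> \<circ> x) (s + 1) = cat (\<sigma> \<circ> x) (t + 1)"
proof -
  obtain a i where t: "cell \<sigma> x t = (a, i)" by fastforce
  with assms have s: "cell \<sigma> x s = (a, i)" by simp
  have "Suc i < length (\<sigma> a)" using cell_boundary[OF assms(1) t] assms(3) by blast
  then show ?thesis
    using cell_facts(3)[OF assms(1)] cell_inner[OF assms(1) t] cell_inner[OF assms(1) s] by metis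
qed

text \<open>At a common cut, the symbol to the right determines the block to the right by its head,
  and the symbol to the left determines the block to the left by its last letter.\<close>

lemma bipermutative_injective:
  assumes ne: "nonempty (\<beta> \<circ> u)" "nonempty (\<beta> \<circ> v)"
    and S: "range u \<subseteq> S" "range v \<subseteq> S"
    and inj: "inj_on (hd \<circ> \<beta>) S" "inj_on (last \<circ> \<beta>) S"
    and eq: "cat (\<beta> \<circ> u) = cat (\<beta> \<circ> v)"
  shows "u = v"
proof (rule synchronized_eq[of \<beta>])
  fix n
  assume b: "start (\<beta> \<circ> u) n = start (\<beta> \<circ> v) n"
  have nil: "\<beta> (u n) \<noteq> []" "\<beta> (v n) \<noteq> []" for n using ne by (simp_all add: nonempty_def)
  have "hd (\<beta> (u n)) = hd (\<beta> (v n))"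
    using cat_block[OF ne(1), of 0 n] cat_block[OF ne(2), of 0 n] nil b eq by (simp add: hd_conv_nth)
  then have "(hd \<circ> \<beta>) (u n) = (hd \<circ> \<beta>) (v n)" by simp
  then show "u n = v n" by (rule inj_onD[OF inj(1)]) (use S in auto)
  have lst: "cat (\<beta> \<circ> w) (start (\<beta> \<circ> w) n - 1) = last (\<beta> (w (n - 1)))"
    if w: "nonempty (\<beta> \<circ> w)" for w
  proof -
    have ne: "\<beta> (w (n - 1)) \<noteq> []" using w by (simp add: nonempty_def)
    have "start (\<beta> \<circ> w) n - 1 = start (\<beta> \<circ> w) (n - 1) + int (length (\<beta> (w (n - 1))) - 1)"
      using start_Suc[of "\<beta> \<circ> w" "n - 1"] ne by (cases "\<beta> (w (n - 1))") auto
    then show ?thesis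
      using cat_block[OF w, of "length (\<beta> (w (n - 1))) - 1" "n - 1"] ne by (simp add: last_conv_nth)
  qed
  have "last (\<beta> (u (n - 1))) = last (\<beta> (v (n - 1)))"
    using lst[OF ne(1)] lst[OF ne(2)] b eq by simp
  then have "(last \<circ> \<beta>) (u (n - 1)) = (last \<circ> \<beta>) (v (n - 1))" by simp
  then show "u (n - 1) = v (n - 1)" by (rule inj_onD[OF inj(2)]) (use S in auto)
qed

text \<open>If the two factorizations share no cut, then at every position one of the two blocks extends
  to the right and thereby reveals the next letter, which in turn determines the other block. So the
  pair of cells evolves deterministically.\<close>

lemma bipermutative_recognizable:
  assumes ne: "nonempty (\<beta> \<circ> x)" "nonempty (\<beta> \<circ> x')"
    and S: "finite S" "range x \<subseteq> S" "range x' \<subseteq> S"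
    and inj: "inj_on (hd \<circ> \<beta>) S" "inj_on (last \<circ> \<beta>) S"
    and eq: "cat (\<beta> \<circ> x') = shift m (cat (\<beta> \<circ> x))"
  shows "(\<exists>p. x' = shift p x \<and> m = start (\<beta> \<circ> x) p) \<or> periodic (cat (\<beta> \<circ> x))"
proof (cases "\<exists>p q. start (\<beta> \<circ> x) p = m + start (\<beta> \<circ> x') q")
  case True
  then obtain p q where pq: "start (\<beta> \<circ> x) p = m + start (\<beta> \<circ> x') q" by blast
  \<comment> \<open>Moving the common cut to the origin of both sequences reduces this case to
    injectivity.\<close>
  have "shift p x = shift q x'"
  proof (rule bipermutative_injective)
    show "cat (\<beta> \<circ> shift p x) = cat (\<beta> \<circ> shift q x')"
      using pq eq by (simp add: comp_shift cat_shift ne add.commute)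
  qed (use ne S inj in \<open>simp_all add: comp_shift\<close>)
  then have "shift (- q) (shift p x) = shift (- q) (shift q x')" by simp
  then have x': "x' = shift (p - q) x" by simp
  moreover have "m = start (\<beta> \<circ> x) (p - q)"
    using pq by (simp add: x' comp_shift start_shift)
  ultimately show ?thesis by blast
next
  case False
  \<comment> \<open>Position \<open>t\<close> of the first concatenation is position
    \<open>t - m\<close> of the second.\<close>
  define W where "W t = (cell \<beta> x t, cell \<beta> x' (t - m))" for t
  have eq': "cat (\<beta> \<circ> x') (t - m) = cat (\<beta> \<circ> x) t" for t
    using eq by (simp add: shift_apply)
  have inj': "inj_on (hd \<circ> \<beta>) (range x)" "inj_on (hd \<circ> \<beta>) (range x')"
    using inj(1) S inj_on_subset by blast+
  have "periodic W"
  proof (rule deterministic_periodic)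
    have "range W \<subseteq> range (cell \<beta> x) \<times> range (cell \<beta> x')" by (auto simp: W_def)
    moreover have "finite (range x)" "finite (range x')" using S finite_subset by blast+
    ultimately show "finite (range W)"
      using finite_range_cell[OF ne(1)] finite_range_cell[OF ne(2)] finite_subset by blast
  next
    fix s t
    assume "W s = W t"
    then have c: "cell \<beta> x s = cell \<beta> x t" "cell \<beta> x' (s - m) = cell \<beta> x' (t - m)"
      by (simp_all add: W_def)
    have "cat (\<beta> \<circ> x) (s + 1) = cat (\<beta> \<circ> x) (t + 1)"
    proof (cases "t + 1 \<in> range (start (\<beta> \<circ> x))")
      case True
      then have "t - m + 1 \<notin> range (start (\<beta> \<circ> x'))" using False by (auto simp: algebra_simps)
      from cat_Suc_eq_if_no_cut[OF ne(2) c(2) this] show ?thesis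
        using eq'[of "s + 1"] eq'[of "t + 1"] by (simp add: algebra_simps)
    qed (rule cat_Suc_eq_if_no_cut[OF ne(1) c(1)])
    then show "W (s + 1) = W (t + 1)"
      using cell_deterministic[OF ne(1) inj'(1) c(1)] cell_deterministic[OF ne(2) inj'(2) c(2)]
        eq'[of "s + 1"] eq'[of "t + 1"] by (simp add: W_def algebra_simps)
  qed
  then have "periodic ((\<lambda>(c, _). \<beta> (fst c) ! snd c) \<circ> W)" by (rule periodic_comp)
  moreover have "(\<lambda>(c, _). \<beta> (fst c) ! snd c) \<circ> W = cat (\<beta> \<circ> x)"
    using cell_facts(3)[OF ne(1) surjective_pairing] by (simp add: W_def fun_eq_iff)
  ultimately show ?thesis by simp
qed

section \<open>Lifting a coincidence to a coarser alphabet\<close>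

text \<open>Whether a position is a cut can be read off one symbol at a fixed offset, by the same
  rule for both sequences, so the coincidence maps cuts to cuts. The origin of \<open>z'\<close> is
  a cut, hence so is \<open>m\<close> for \<open>z\<close>.\<close>

lemma recognizable_if_cuts_visible:
  assumes ne: "nonempty z" "nonempty z'"
    and cuts: "range (start z) = {t. cat z (t - e) \<noteq> c}" "range (start z') = {t. cat z' (t - e) \<noteq> c}"
    and eq: "cat z' = shift m (cat z)"
  shows "\<exists>p. z' = shift p z \<and> m = start z p"
proof -
  have eq': "cat z' t = cat z (t + m)" for t using eq by (simp add: shift_apply)
  have "0 \<in> range (start z')" by (metis rangeI start_0)
  then have "m \<in> range (start z)" unfolding cuts by (simp add: eq' algebra_simps)
  then obtain p where p: "m = start z p" by blast
  have "z' = shift p z"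
  proof (rule eq_if_same_cuts)
    show "cat z' = cat (shift p z)" using eq p by (simp add: cat_shift ne)
    have "range (start (shift p z)) = {t. t + m \<in> range (start z)}"
    proof (intro equalityI subsetI; clarsimp)
      show "start (shift p z) n + m \<in> range (start z)" for n
        using p by (simp add: start_shift)
      show "t \<in> range (start (shift p z))" if "t + m = start z n" for t n
        using that p start_shift[of p z "n - p"] by (metis add_diff_cancel_right' diff_add_cancel rangeI)
    qed
    then show "range (start z') = range (start (shift p z))"
      unfolding cuts by (simp add: eq' algebra_simps)
  qed (use ne in simp_all)
  with p show ?thesis by blast
qed

text \<open>Blocks have the form d c ... c with d different from c, so the symbols other than
  \<open>c\<close> mark the beginnings of blocks. The offset 0 is kept to match the form shared with
  the mirrored case.\<close>

lemma cuts_visible_at_heads: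
  assumes ne: "nonempty w" and hd: "\<And>n. hd (w n) \<noteq> c" and tl: "\<And>n. set (tl (w n)) \<subseteq> {c}"
  shows "range (start w) = {t. cat w (t - 0) \<noteq> c}"
proof (intro equalityI subsetI)
  have nil: "w n \<noteq> []" for n using ne by (simp add: nonempty_def)
  fix t
  show "t \<in> {t. cat w (t - 0) \<noteq> c}" if "t \<in> range (start w)"
  proof -
    from that obtain n where "t = start w n" by blast
    then show ?thesis
      using cat_block[OF ne, of 0 n] hd[of n] nil[of n] by (simp add: hd_conv_nth)
  qed
  assume "t \<in> {t. cat w (t - 0) \<noteq> c}"
  then have t: "cat w t \<noteq> c" by simp
  obtain n i where ni: "t = start w n + int i" "i < length (w n)" using block_cases[OF ne] .
  have "i = 0"
  proof (rule ccontr)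
    assume "i \<noteq> 0"
    then have "w n ! i = tl (w n) ! (i - 1)" "i - 1 < length (tl (w n))"
      using ni(2) by (auto simp: nth_tl)
    then have "w n ! i \<in> set (tl (w n))" by simp
    then show False using t tl[of n] ni cat_block[OF ne, of i n] by auto
  qed
  then show "t \<in> range (start w)" using ni by simp
qed

text \<open>Mirror image with blocks c ... c d: a cut is recognized by the symbol just before it,
  hence the offset 1.\<close>

lemma cuts_visible_at_lasts:
  assumes ne: "nonempty w" and last: "\<And>n. last (w n) \<noteq> c" and butlast: "\<And>n. set (butlast (w n)) \<subseteq> {c}"
  shows "range (start w) = {t. cat w (t - 1) \<noteq> c}"
proof (intro equalityI subsetI)
  have nil: "w n \<noteq> []" for n using ne by (simp add: nonempty_def)
  fix t
  show "t \<in> {t. cat w (t - 1) \<noteq> c}" if "t \<in> range (start w)"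
  proof -
    from that obtain n where n: "t = start w n" by blast
    have "start w n - 1 = start w (n - 1) + int (length (w (n - 1)) - 1)"
      using start_Suc[of w "n - 1"] nil[of "n - 1"] by (cases "w (n - 1)") auto
    then show ?thesis
      using n cat_block[OF ne, of "length (w (n - 1)) - 1" "n - 1"] last[of "n - 1"] nil[of "n - 1"]
      by (simp add: last_conv_nth)
  qed
  assume "t \<in> {t. cat w (t - 1) \<noteq> c}"
  then have t: "cat w (t - 1) \<noteq> c" by simp
  obtain n i where ni: "t - 1 = start w n + int i" "i < length (w n)" using block_cases[OF ne] .
  have "Suc i = length (w n)"
  proof (rule ccontr)
    assume "Suc i \<noteq> length (w n)"
    then have "w n ! i = butlast (w n) ! i" "i < length (butlast (w n))"
      using ni(2) by (auto simp: nth_butlast)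
    then have "w n ! i \<in> set (butlast (w n))" by simp
    then show False using t butlast[of n] ni cat_block[OF ne, of i n] by auto
  qed
  then have "t = start w (n + 1)" using ni by (simp add: start_Suc)
  then show "t \<in> range (start w)" by blast
qed

section \<open>Grouping the letters of words\<close>

text \<open>Induction from the right: a new last letter \<open>c\<close> joins the last piece, any
  other letter opens a new piece. Since \<open>w\<close> does not begin with \<open>c\<close>, there
  is always a piece to join.\<close>

lemma split_at_heads:
  assumes "w \<noteq> []" "hd w \<noteq> c"
  shows "\<exists>ws. concat ws = w \<and> (\<forall>v\<in>set ws. v \<noteq> [] \<and> hd v \<noteq> c \<and> set (tl v) \<subseteq> {c})"
  using assms
proof (induction w rule: rev_induct)
  case (snoc d w)
  show ?case
  proof (cases "w = []")
    case True
    then show ?thesis using snoc.prems by (intro exI[of _ "[[d]]"]) auto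
  next
    case False
    then obtain ws where ws: "concat ws = w" "\<forall>v\<in>set ws. v \<noteq> [] \<and> hd v \<noteq> c \<and> set (tl v) \<subseteq> {c}"
      using snoc by (auto simp: hd_append)
    with False obtain us v where us: "ws = us @ [v]" by (metis append_butlast_last_id concat.simps(1))
    show ?thesis
    proof (cases "d = c")
      case True
      with ws us show ?thesis by (intro exI[of _ "us @ [v @ [d]]"]) auto
    next
      case False
      with ws us show ?thesis by (intro exI[of _ "ws @ [[d]]"]) auto
    qed
  qed
qed simp

lemma split_at_lasts:
  assumes "w \<noteq> []" "last w \<noteq> c"
  shows "\<exists>ws. concat ws = w \<and> (\<forall>v\<in>set ws. v \<noteq> [] \<and> last v \<noteq> c \<and> set (butlast v) \<subseteq> {c})"
proof -
  have "rev w \<noteq> []" "hd (rev w) \<noteq> c" using assms by (simp_all add: hd_rev)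
  from split_at_heads[OF this] obtain ws where ws: "concat ws = rev w"
    "\<forall>v\<in>set ws. v \<noteq> [] \<and> hd v \<noteq> c \<and> set (tl v) \<subseteq> {c}"
    by blast
  have "concat (rev (map rev ws)) = w"
    using ws(1) by (metis rev_concat rev_map rev_rev_ident)
  moreover have "v \<noteq> [] \<and> last v \<noteq> c \<and> set (butlast v) \<subseteq> {c}" if "v \<in> set (rev (map rev ws))" for v
  proof -
    from that obtain u where u: "u \<in> set ws" "v = rev u" by auto
    moreover have "butlast (rev u) = rev (tl u)" by (cases u) auto
    ultimately show ?thesis using ws(2) by (auto simp: last_rev)
  qed
  ultimately show ?thesis by blast
qed

lemma length_concat_ge:
  "[] \<notin> set ws \<Longrightarrow> length ws \<le> length (concat ws)"
proof (induction ws)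
  case (Cons u ws)
  then have "1 \<le> length u" "length ws \<le> length (concat ws)" by (auto simp: Suc_le_eq)
  then show ?case by simp
qed simp

lemma length_concat_gr:
  "[] \<notin> set ws \<Longrightarrow> v \<in> set ws \<Longrightarrow> 2 \<le> length v \<Longrightarrow> length ws < length (concat ws)"
proof (induction ws)
  case (Cons u ws)
  then have "u \<noteq> []" "length ws \<le> length (concat ws)" using length_concat_ge by auto
  then show ?case using Cons by (cases "v = u") (auto simp: neq_Nil_conv)
qed simp

text \<open>The words in \<open>\<beta> a\<close> are read as letters of a new alphabet, over which the coincidence
  \<open>\<sigma>(x') = T\<^sup>k \<sigma>(x)\<close> already holds.\<close>

definition lifts :: "('a \<Rightarrow> 'b list) \<Rightarrow> (int \<Rightarrow> 'a) \<Rightarrow> (int \<Rightarrow> 'a) \<Rightarrow> int \<Rightarrow> ('a \<Rightarrow> 'b list list) \<Rightarrow> int \<Rightarrow> bool" where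
  "lifts \<sigma> x x' k \<beta> m \<longleftrightarrow> (\<forall>a. \<beta> a \<noteq> [] \<and> [] \<notin> set (\<beta> a) \<and> concat (\<beta> a) = \<sigma> a) \<and>
     cat (\<beta> \<circ> x') = shift m (cat (\<beta> \<circ> x)) \<and> k = start (cat (\<beta> \<circ> x)) m"

lemma nonempty_cat:
  assumes "nonempty w" "\<And>n. [] \<notin> set (w n)"
  shows "nonempty (cat w)"
proof -
  have "range (cat w) \<subseteq> - {[]}" using assms by (intro range_cat) auto
  then show ?thesis unfolding nonempty_def by (metis ComplD insertI1 rangeI subsetD)
qed

text \<open>The finest lift, with one piece per letter; it starts the minimization.\<close>

lemma lifts_letters:
  assumes "\<And>a. \<sigma> a \<noteq> []" "cat (\<sigma> \<circ> x') = shift k (cat (\<sigma> \<circ> x))"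
  shows "lifts \<sigma> x x' k (\<lambda>a. map (\<lambda>b. [b]) (\<sigma> a)) k"
proof -
  have c: "cat ((\<lambda>a. map (\<lambda>b. [b]) (\<sigma> a)) \<circ> u) = (\<lambda>b. [b]) \<circ> cat (\<sigma> \<circ> u)" for u
    using cat_map[of "\<sigma> \<circ> u" "\<lambda>b. [b]"] assms(1) by (simp add: nonempty_def comp_def)
  have "start ((\<lambda>b. [b]) \<circ> y) k = k" for y :: "int \<Rightarrow> 'b"
    by (rule int_fun_eqI) (simp_all add: start_Suc)
  moreover have "concat (map (\<lambda>b. [b]) v) = v" for v :: "'b list" by (induction v) auto
  ultimately show ?thesis unfolding lifts_def c using assms by (auto simp: comp_shift)
qed

text \<open>\<open>\<gamma> a\<close> groups the pieces of \<open>\<beta> a\<close>. If the group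
  boundaries are visible in the sequence of pieces, the coincidence of piece sequences is one of
  group sequences, and gluing each group into a single word gives a coarser lift.\<close>

lemma lifts_regroup:
  assumes l: "lifts \<sigma> x x' k \<beta> m"
    and \<gamma>: "\<And>a. \<gamma> a \<noteq> []" "\<And>a. [] \<notin> set (\<gamma> a)" "\<And>a. concat (\<gamma> a) = \<beta> a"
    and cuts: "range (start (cat (\<gamma> \<circ> x))) = {t. cat (cat (\<gamma> \<circ> x)) (t - e) \<noteq> c}"
      "range (start (cat (\<gamma> \<circ> x'))) = {t. cat (cat (\<gamma> \<circ> x')) (t - e) \<noteq> c}"
  shows "\<exists>m'. lifts \<sigma> x x' k (\<lambda>a. map concat (\<gamma> a)) m'"
proof -
  have \<beta>: "\<beta> a \<noteq> []" "[] \<notin> set (\<beta> a)" "concat (\<beta> a) = \<sigma> a" for a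
    using l by (auto simp: lifts_def)
  have ne\<gamma>: "nonempty (\<gamma> \<circ> u)" for u using \<gamma>(1) by (simp add: nonempty_def)
  have ne: "nonempty (cat (\<gamma> \<circ> u))" for u using \<gamma> by (intro nonempty_cat) (auto simp: nonempty_def)
  have cc: "cat (\<beta> \<circ> u) = cat (cat (\<gamma> \<circ> u))" for u
    using cat_cat[OF ne\<gamma>, of id u] ne[of u] \<gamma>(3) by (simp add: comp_def)
  have "cat (cat (\<gamma> \<circ> x')) = shift m (cat (cat (\<gamma> \<circ> x)))"
    using l by (simp add: lifts_def cc)
  from recognizable_if_cuts_visible[OF ne ne cuts this]
  obtain p where p: "cat (\<gamma> \<circ> x') = shift p (cat (\<gamma> \<circ> x))" "m = start (cat (\<gamma> \<circ> x)) p" by blast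
  have c: "cat ((\<lambda>a. map concat (\<gamma> a)) \<circ> u) = concat \<circ> cat (\<gamma> \<circ> u)" for u
    using cat_map[OF ne\<gamma>, of concat u] by (simp add: comp_def)
  have "nonempty (cat (\<beta> \<circ> x))" using \<beta> by (intro nonempty_cat) (auto simp: nonempty_def)
  then have "nonempty (id \<circ> cat (cat (\<gamma> \<circ> x)))" unfolding cc by simp
  from start_cat[OF ne this, of p]
  have "start (concat \<circ> cat (\<gamma> \<circ> x)) p = start (cat (cat (\<gamma> \<circ> x))) (start (cat (\<gamma> \<circ> x)) p)"
    by (simp add: comp_def)
  then have "k = start (concat \<circ> cat (\<gamma> \<circ> x)) p"
    using l p(2) by (simp add: lifts_def cc)
  moreover have "[] \<notin> set (map concat (\<gamma> a))" for a
  proof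
    assume "[] \<in> set (map concat (\<gamma> a))"
    then obtain v where v: "v \<in> set (\<gamma> a)" "concat v = []" by auto
    then have "v \<noteq> []" using \<gamma>(2) by metis
    with v(2) have "[] \<in> set v" by (cases v) auto
    with v(1) have "[] \<in> set (\<beta> a)" using \<gamma>(3)[of a] by (metis UN_I set_concat)
    then show False using \<beta>(2) by blast
  qed
  moreover have "concat (map concat vs) = concat (concat vs)" for vs :: "'b list list list"
    by (induction vs) auto
  then have "concat (map concat (\<gamma> a)) = \<sigma> a" for a using \<gamma>(3) \<beta>(3) by simp
  ultimately have "lifts \<sigma> x x' k (\<lambda>a. map concat (\<gamma> a)) p"
    unfolding lifts_def c p(1) comp_shift using \<gamma>(1) by simp
  then show ?thesis by blast
qed

text \<open>If \<open>c\<close> never came first in a \<open>\<beta> a\<close> with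
  \<open>a \<in> S\<close>, each such word could be cut before every piece other than
  \<open>c\<close>. These boundaries are visible, and the group containing \<open>c\<close> has at
  least two pieces, so regrouping would lower the number of pieces. The claim about last pieces is
  symmetric.\<close>

lemma lifts_minimal:
  assumes fin: "finite S" and S: "range x \<subseteq> S" "range x' \<subseteq> S" and l: "lifts \<sigma> x x' k \<beta> m"
    and min: "\<And>\<beta>' m'. lifts \<sigma> x x' k \<beta>' m' \<Longrightarrow> (\<Sum>a\<in>S. length (\<beta> a)) \<le> (\<Sum>a\<in>S. length (\<beta>' a))"
    and c: "a \<in> S" "c \<in> set (\<beta> a)"
  shows "c \<in> (hd \<circ> \<beta>) ` S" "c \<in> (last \<circ> \<beta>) ` S"
proof -
  have \<beta>: "\<beta> a \<noteq> []" "[] \<notin> set (\<beta> a)" "concat (\<beta> a) = \<sigma> a" for a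
    using l by (auto simp: lifts_def)
  \<comment> \<open>Common end of both arguments: \<open>e\<close> is 0 for cuts seen at heads and 1
    for cuts seen at lasts.\<close>
  have no_regroup: False
    if \<gamma>: "\<And>a. \<gamma> a \<noteq> []" "\<And>a. [] \<notin> set (\<gamma> a)" "\<And>a. concat (\<gamma> a) = \<beta> a"
      and v: "v \<in> set (\<gamma> a)" "2 \<le> length v"
      and cuts: "\<And>u. range u \<subseteq> S \<Longrightarrow> range (start (cat (\<gamma> \<circ> u))) = {t. cat (cat (\<gamma> \<circ> u)) (t - e) \<noteq> c}"
    for \<gamma> e v
  proof -
    have "\<exists>m'. lifts \<sigma> x x' k (\<lambda>a. map concat (\<gamma> a)) m'"
      by (rule lifts_regroup[OF l \<gamma> cuts[OF S(1)] cuts[OF S(2)]])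
    then obtain m' where "lifts \<sigma> x x' k (\<lambda>a. map concat (\<gamma> a)) m'" by blast
    from min[OF this] have "(\<Sum>a\<in>S. length (\<beta> a)) \<le> (\<Sum>a\<in>S. length (\<gamma> a))" by simp
    moreover have "(\<Sum>a\<in>S. length (\<gamma> a)) < (\<Sum>a\<in>S. length (\<beta> a))"
    proof (rule sum_strict_mono_ex1[OF fin])
      show "\<forall>a\<in>S. length (\<gamma> a) \<le> length (\<beta> a)" using \<gamma> length_concat_ge by metis
      show "\<exists>a\<in>S. length (\<gamma> a) < length (\<beta> a)"
        using c(1) length_concat_gr[OF \<gamma>(2) v] \<gamma>(3) by metis
    qed
    ultimately show False by simp
  qed
  have long: "2 \<le> length v" if "c \<in> set v" "hd v \<noteq> c \<or> last v \<noteq> c" for v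
  proof (cases v)
    case (Cons d v')
    with that show ?thesis by (cases v') auto
  qed (use that in simp)
  show "c \<in> (hd \<circ> \<beta>) ` S"
  proof (rule ccontr)
    assume "c \<notin> (hd \<circ> \<beta>) ` S"
    then have hd: "hd (\<beta> a) \<noteq> c" if "a \<in> S" for a using that by auto
    \<comment> \<open>Outside \<open>S\<close> the whole word is taken as one group, because
      \<open>lifts\<close> constrains every letter.\<close>
    have "\<exists>ws. ws \<noteq> [] \<and> [] \<notin> set ws \<and> concat ws = \<beta> a \<and>
      (a \<in> S \<longrightarrow> (\<forall>v\<in>set ws. hd v \<noteq> c \<and> set (tl v) \<subseteq> {c}))" for a
    proof (cases "a \<in> S")
      case True
      obtain ws where ws: "concat ws = \<beta> a" "\<forall>v\<in>set ws. v \<noteq> [] \<and> hd v \<noteq> c \<and> set (tl v) \<subseteq> {c}"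
        using split_at_heads[OF \<beta>(1) hd[OF True]] by blast
      moreover have "ws \<noteq> []" using ws(1) \<beta>(1)[of a] by auto
      ultimately show ?thesis by blast
    next
      case False
      then show ?thesis using \<beta>(1)[of a] by (intro exI[of _ "[\<beta> a]"]) auto
    qed
    from choice[OF allI[OF this]] obtain \<gamma> where \<gamma>':
      "\<forall>a. \<gamma> a \<noteq> [] \<and> [] \<notin> set (\<gamma> a) \<and> concat (\<gamma> a) = \<beta> a \<and>
        (a \<in> S \<longrightarrow> (\<forall>v\<in>set (\<gamma> a). hd v \<noteq> c \<and> set (tl v) \<subseteq> {c}))" ..
    then have \<gamma>: "\<gamma> a \<noteq> []" "[] \<notin> set (\<gamma> a)" "concat (\<gamma> a) = \<beta> a" for a
      by simp_all
    have heads: "hd v \<noteq> c \<and> set (tl v) \<subseteq> {c}" if "a \<in> S" "v \<in> set (\<gamma> a)" for a v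
      using \<gamma>'[rule_format, of a] that by blast
    obtain v where v: "v \<in> set (\<gamma> a)" "c \<in> set v" using c(2) \<gamma>(3)[of a] by (metis UN_E set_concat)
    show False
    proof (rule no_regroup[OF \<gamma> v(1) long[OF v(2)]])
      show "hd v \<noteq> c \<or> last v \<noteq> c" using heads[OF c(1) v(1)] by simp
      fix u :: "int \<Rightarrow> 'a"
      assume u: "range u \<subseteq> S"
      have ne: "nonempty (\<gamma> \<circ> u)" using \<gamma>(1) by (simp add: nonempty_def)
      have "range (cat (\<gamma> \<circ> u)) \<subseteq> {v. hd v \<noteq> c \<and> set (tl v) \<subseteq> {c}}"
      proof (rule range_cat[OF ne])
        fix n
        have "u n \<in> S" using u by blast
        then show "set ((\<gamma> \<circ> u) n) \<subseteq> {v. hd v \<noteq> c \<and> set (tl v) \<subseteq> {c}}" using heads by auto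
      qed
      then show "range (start (cat (\<gamma> \<circ> u))) = {t. cat (cat (\<gamma> \<circ> u)) (t - 0) \<noteq> c}"
        using \<gamma>(2) by (intro cuts_visible_at_heads nonempty_cat[OF ne]) auto
    qed
  qed
  show "c \<in> (last \<circ> \<beta>) ` S"
  proof (rule ccontr)
    assume "c \<notin> (last \<circ> \<beta>) ` S"
    then have last: "last (\<beta> a) \<noteq> c" if "a \<in> S" for a using that by auto
    have "\<exists>ws. ws \<noteq> [] \<and> [] \<notin> set ws \<and> concat ws = \<beta> a \<and>
      (a \<in> S \<longrightarrow> (\<forall>v\<in>set ws. last v \<noteq> c \<and> set (butlast v) \<subseteq> {c}))" for a
    proof (cases "a \<in> S")
      case True
      obtain ws where ws: "concat ws = \<beta> a" "\<forall>v\<in>set ws. v \<noteq> [] \<and> last v \<noteq> c \<and> set (butlast v) \<subseteq> {c}"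
        using split_at_lasts[OF \<beta>(1) last[OF True]] by blast
      moreover have "ws \<noteq> []" using ws(1) \<beta>(1)[of a] by auto
      ultimately show ?thesis by blast
    next
      case False
      then show ?thesis using \<beta>(1)[of a] by (intro exI[of _ "[\<beta> a]"]) auto
    qed
    from choice[OF allI[OF this]] obtain \<gamma> where \<gamma>':
      "\<forall>a. \<gamma> a \<noteq> [] \<and> [] \<notin> set (\<gamma> a) \<and> concat (\<gamma> a) = \<beta> a \<and>
        (a \<in> S \<longrightarrow> (\<forall>v\<in>set (\<gamma> a). last v \<noteq> c \<and> set (butlast v) \<subseteq> {c}))" ..
    then have \<gamma>: "\<gamma> a \<noteq> []" "[] \<notin> set (\<gamma> a)" "concat (\<gamma> a) = \<beta> a" for a
      by simp_all
    have lasts: "last v \<noteq> c \<and> set (butlast v) \<subseteq> {c}" if "a \<in> S" "v \<in> set (\<gamma> a)" for a v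
      using \<gamma>'[rule_format, of a] that by blast
    obtain v where v: "v \<in> set (\<gamma> a)" "c \<in> set v" using c(2) \<gamma>(3)[of a] by (metis UN_E set_concat)
    show False
    proof (rule no_regroup[OF \<gamma> v(1) long[OF v(2)]])
      show "hd v \<noteq> c \<or> last v \<noteq> c" using lasts[OF c(1) v(1)] by simp
      fix u :: "int \<Rightarrow> 'a"
      assume u: "range u \<subseteq> S"
      have ne: "nonempty (\<gamma> \<circ> u)" using \<gamma>(1) by (simp add: nonempty_def)
      have "range (cat (\<gamma> \<circ> u)) \<subseteq> {v. last v \<noteq> c \<and> set (butlast v) \<subseteq> {c}}"
      proof (rule range_cat[OF ne])
        fix n
        have "u n \<in> S" using u by blast
        then show "set ((\<gamma> \<circ> u) n) \<subseteq> {v. last v \<noteq> c \<and> set (butlast v) \<subseteq> {c}}" using lasts by auto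
      qed
      then show "range (start (cat (\<gamma> \<circ> u))) = {t. cat (cat (\<gamma> \<circ> u)) (t - 1) \<noteq> c}"
        using \<gamma>(2) by (intro cuts_visible_at_lasts nonempty_cat[OF ne]) auto
    qed
  qed
qed

section \<open>Elementary and reducible morphisms\<close>

lemma shift_multiple:
  assumes "shift k y = y"
  shows "shift (k * q) y = y"
proof (induction q rule: int_induct[where k = 0])
  case (step1 q)
  have "shift (k * (q + 1)) y = shift (k * q) (shift k y)" by (simp add: algebra_simps)
  then show ?case using step1 assms by simp
next
  case (step2 q)
  have "shift (k * (q - 1)) y = shift (k * (q - 1)) (shift k y)" using assms by simp
  also have "\<dots> = shift (k * q) y" by (simp add: algebra_simps)
  finally show ?case using step2 by simp
qed simp

text \<open>Morphisms that are not reducible are usually called elementary.\<close>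

definition reducible :: "('a \<Rightarrow> 'a list) \<Rightarrow> 'a set \<Rightarrow> bool" where
  "reducible \<sigma> S \<longleftrightarrow> (\<exists>C \<alpha> \<beta>. finite C \<and> card C < card S \<and> (\<forall>a. \<alpha> a \<noteq> [] \<and> \<beta> a \<noteq> []) \<and>
     (\<forall>a\<in>S. set (\<beta> a) \<subseteq> C \<and> concat (map \<alpha> (\<beta> a)) = \<sigma> a) \<and> (\<forall>c\<in>C. set (\<alpha> c) \<subseteq> S))"

text \<open>The pieces are words, while the intermediate alphabet has to consist of letters of type
  \<open>'a\<close>. Being fewer than the elements of \<open>S\<close>, the pieces can be coded
  injectively by letters of \<open>S\<close>.\<close>

lemma reducibleI:
  assumes fin: "finite S"
    and \<beta>: "\<And>a. \<beta> a \<noteq> []" "\<And>a. [] \<notin> set (\<beta> a)" "\<And>a. concat (\<beta> a) = \<sigma> a"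
    and \<sigma>: "\<And>a. a \<in> S \<Longrightarrow> set (\<sigma> a) \<subseteq> S"
    and card: "card (\<Union>a\<in>S. set (\<beta> a)) < card S"
  shows "reducible \<sigma> S"
proof -
  let ?D = "\<Union>a\<in>S. set (\<beta> a)"
  have finD: "finite ?D" using fin by simp
  obtain g where g: "g ` ?D \<subseteq> S" "inj_on g ?D"
    using card_le_inj[OF finD fin] card by auto
  \<comment> \<open>\<open>\<alpha>\<close> decodes a letter into its piece; the default keeps it
    non-empty off the codes.\<close>
  define \<alpha> where "\<alpha> c = (if c \<in> g ` ?D then inv_into ?D g c else [undefined])" for c
  have \<alpha>g: "\<alpha> (g d) = d" if "d \<in> ?D" for d
    using that g(2) by (simp add: \<alpha>_def del: UN_iff)
  show ?thesis unfolding reducible_def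
  proof (intro exI conjI ballI allI)
    show "finite (g ` ?D)" using finD by simp
    show "card (g ` ?D) < card S" using card_image_le[OF finD, of g] card by simp
    show "\<alpha> c \<noteq> []" for c
    proof (cases "c \<in> g ` ?D")
      case True
      then obtain d where "d \<in> ?D" "c = g d" by blast
      then show ?thesis using \<alpha>g \<beta>(2) by auto
    qed (simp add: \<alpha>_def)
    show "map g (\<beta> a) \<noteq> []" for a using \<beta>(1) by simp
    show "set (map g (\<beta> a)) \<subseteq> g ` ?D" if "a \<in> S" for a using that by auto
    show "concat (map \<alpha> (map g (\<beta> a))) = \<sigma> a" if "a \<in> S" for a
    proof -
      have "map \<alpha> (map g (\<beta> a)) = \<beta> a" using that \<alpha>g by (auto simp: comp_def intro!: map_idI)
      then show ?thesis using \<beta>(3) by simp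
    qed
    show "set (\<alpha> c) \<subseteq> S" if "c \<in> g ` ?D" for c
    proof -
      from that obtain a d where "a \<in> S" "d \<in> set (\<beta> a)" "c = g d" by auto
      moreover from this have "\<alpha> c = d" using \<alpha>g[of d] by blast
      ultimately have "set (\<alpha> c) \<subseteq> set (concat (\<beta> a))" by auto
      then show ?thesis using \<beta>(3) \<sigma>[OF \<open>a \<in> S\<close>] by simp
    qed
  qed
qed

text \<open>Take a lift with the fewest pieces counted over \<open>S\<close>. Then
  \<open>hd \<circ> \<beta>\<close> and \<open>last \<circ> \<beta>\<close> map \<open>S\<close>
  onto the set of pieces, which has at least \<open>card S\<close> elements because
  \<open>\<sigma>\<close> is not reducible. A surjection onto a set at least as large is
  injective.\<close>

lemma elementary_lift:
  assumes fin: "finite S" and \<sigma>: "\<And>a. \<sigma> a \<noteq> []" "\<And>a. a \<in> S \<Longrightarrow> set (\<sigma> a) \<subseteq> S"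
    and elem: "\<not> reducible \<sigma> S" and S: "range x \<subseteq> S" "range x' \<subseteq> S"
    and eq: "cat (\<sigma> \<circ> x') = shift k (cat (\<sigma> \<circ> x))"
  obtains \<beta> m where "lifts \<sigma> x x' k \<beta> m" "inj_on (hd \<circ> \<beta>) S" "inj_on (last \<circ> \<beta>) S"
proof -
  let ?P = "\<lambda>\<beta>. \<exists>m. lifts \<sigma> x x' k \<beta> m"
  obtain \<beta> where "?P \<beta>"
    and min: "\<And>\<beta>'. ?P \<beta>' \<Longrightarrow> (\<Sum>a\<in>S. length (\<beta> a)) \<le> (\<Sum>a\<in>S. length (\<beta>' a))"
    using ex_has_least_nat[of ?P "\<lambda>a. map (\<lambda>b. [b]) (\<sigma> a)" "\<lambda>\<beta>. \<Sum>a\<in>S. length (\<beta> a)"]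
      lifts_letters[of \<sigma>, OF \<sigma>(1) eq] by blast
  then obtain m where l: "lifts \<sigma> x x' k \<beta> m" by blast
  have \<beta>: "\<beta> a \<noteq> []" "[] \<notin> set (\<beta> a)" "concat (\<beta> a) = \<sigma> a" for a
    using l by (auto simp: lifts_def)
  let ?D = "\<Union>a\<in>S. set (\<beta> a)"
  have used: "c \<in> (hd \<circ> \<beta>) ` S \<and> c \<in> (last \<circ> \<beta>) ` S" if c: "c \<in> ?D" for c
  proof -
    from c obtain a where a: "a \<in> S" "c \<in> set (\<beta> a)" by blast
    have min': "(\<Sum>a\<in>S. length (\<beta> a)) \<le> (\<Sum>a\<in>S. length (\<beta>' a))" if "lifts \<sigma> x x' k \<beta>' m'" for \<beta>' m'
      by (rule min) (use that in blast)
    show ?thesis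
      by (intro conjI lifts_minimal[OF fin S l _ a]; erule min')
  qed
  have "?D \<subseteq> (hd \<circ> \<beta>) ` S" "?D \<subseteq> (last \<circ> \<beta>) ` S" using used by blast+
  moreover have "(hd \<circ> \<beta>) ` S \<subseteq> ?D" "(last \<circ> \<beta>) ` S \<subseteq> ?D"
    using \<beta>(1) by (auto intro!: bexI)
  ultimately have D: "(hd \<circ> \<beta>) ` S = ?D" "(last \<circ> \<beta>) ` S = ?D" by simp_all
  have "\<not> card ?D < card S" using reducibleI[of S \<beta> \<sigma>, OF fin \<beta> \<sigma>(2)] elem by blast
  then have "card ((hd \<circ> \<beta>) ` S) = card S" "card ((last \<circ> \<beta>) ` S) = card S"
    using card_image_le[OF fin, of "hd \<circ> \<beta>"] card_image_le[OF fin, of "last \<circ> \<beta>"] D by simp_all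
  then have "inj_on (hd \<circ> \<beta>) S" "inj_on (last \<circ> \<beta>) S" using fin by (auto intro: eq_card_imp_inj_on)
  with l show ?thesis by (rule that)
qed

lemma elementary_injective:
  assumes fin: "finite S" and \<sigma>: "\<And>a. \<sigma> a \<noteq> []" "\<And>a. a \<in> S \<Longrightarrow> set (\<sigma> a) \<subseteq> S"
    and elem: "\<not> reducible \<sigma> S" and S: "range u \<subseteq> S" "range v \<subseteq> S"
    and eq: "cat (\<sigma> \<circ> u) = cat (\<sigma> \<circ> v)"
  shows "u = v"
proof -
  have "cat (\<sigma> \<circ> u) = shift 0 (cat (\<sigma> \<circ> v))" using eq by simp
  from elementary_lift[OF fin \<sigma> elem S(2,1) this]
  obtain \<beta> m where l: "lifts \<sigma> v u 0 \<beta> m" and inj: "inj_on (hd \<circ> \<beta>) S" "inj_on (last \<circ> \<beta>) S" by metis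
  have ne: "nonempty (\<beta> \<circ> w)" for w using l by (simp add: lifts_def nonempty_def)
  have "nonempty (cat (\<beta> \<circ> v))"
    by (rule nonempty_cat[OF ne]) (use l in \<open>simp add: lifts_def\<close>)
  \<comment> \<open>Shift 0 in \<open>\<sigma>(v)\<close> corresponds to shift 0 in the sequence of
    pieces, as distinct indices have distinct starts.\<close>
  from start_eq_iff[OF this, of 0 m] have "m = 0" using l by (simp add: lifts_def)
  then have "cat (\<beta> \<circ> u) = cat (\<beta> \<circ> v)" using l by (simp add: lifts_def)
  from bipermutative_injective[OF ne ne S inj this] show ?thesis .
qed

text \<open>The lift \<open>\<beta>\<close> is recognizable unless its sequence of pieces is
  periodic, and flattening a periodic sequence of pieces would make \<open>\<sigma>(x)\<close>
  periodic. Cuts of \<open>\<sigma>\<close> are those of \<open>\<beta>\<close> followed by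
  flattening.\<close>

lemma elementary_recognizable:
  assumes fin: "finite S" and \<sigma>: "\<And>a. \<sigma> a \<noteq> []" "\<And>a. a \<in> S \<Longrightarrow> set (\<sigma> a) \<subseteq> S"
    and elem: "\<not> reducible \<sigma> S" and S: "range x \<subseteq> S" "range x' \<subseteq> S"
    and eq: "cat (\<sigma> \<circ> x') = shift k (cat (\<sigma> \<circ> x))" and aper: "aperiodic (cat (\<sigma> \<circ> x))"
  shows "\<exists>p. x' = shift p x \<and> k = start (\<sigma> \<circ> x) p"
proof -
  obtain \<beta> m where l: "lifts \<sigma> x x' k \<beta> m" and inj: "inj_on (hd \<circ> \<beta>) S" "inj_on (last \<circ> \<beta>) S"
    using elementary_lift[OF fin \<sigma> elem S eq] by metis
  have ne: "nonempty (\<beta> \<circ> w)" for w using l by (simp add: lifts_def nonempty_def)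
  have ne': "nonempty (cat (\<beta> \<circ> x))"
    by (rule nonempty_cat[OF ne]) (use l in \<open>simp add: lifts_def\<close>)
  then have ne'': "nonempty (id \<circ> cat (\<beta> \<circ> x))" by simp
  have \<sigma>\<beta>: "(\<lambda>n. concat (map id ((\<beta> \<circ> x) n))) = \<sigma> \<circ> x" using l by (simp add: lifts_def fun_eq_iff)
  have "cat (\<sigma> \<circ> x) = cat (cat (\<beta> \<circ> x))"
    using cat_cat[OF ne ne''] \<sigma>\<beta> by simp
  then have "\<not> periodic (cat (\<beta> \<circ> x))" using aper periodic_cat[OF ne'] by metis
  moreover have "cat (\<beta> \<circ> x') = shift m (cat (\<beta> \<circ> x))" using l by (simp add: lifts_def)
  ultimately obtain p where p: "x' = shift p x" "m = start (\<beta> \<circ> x) p"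
    using bipermutative_recognizable[OF ne ne fin S inj] by blast
  have "k = start (cat (\<beta> \<circ> x)) (start (\<beta> \<circ> x) p)" using l p by (simp add: lifts_def)
  also have "\<dots> = start (\<sigma> \<circ> x) p" using start_cat[OF ne ne'', of p] \<sigma>\<beta> by simp
  finally show ?thesis using p by blast
qed

text \<open>If \<open>k\<close> is a period of \<open>\<sigma>(x)\<close>, two of
  \<open>k + 1\<close> consecutive cuts are congruent modulo \<open>k\<close>. Shifting
  \<open>\<sigma>(x)\<close> to either cut gives the same sequence, so injectivity identifies the
  corresponding shifts of \<open>x\<close>.\<close>

lemma elementary_reflects_periodic:
  assumes fin: "finite S" and \<sigma>: "\<And>a. \<sigma> a \<noteq> []" "\<And>a. a \<in> S \<Longrightarrow> set (\<sigma> a) \<subseteq> S"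
    and elem: "\<not> reducible \<sigma> S" and S: "range x \<subseteq> S"
    and per: "periodic (cat (\<sigma> \<circ> x))"
  shows "periodic x"
proof -
  let ?y = "cat (\<sigma> \<circ> x)"
  have ne: "nonempty (\<sigma> \<circ> x)" using \<sigma>(1) by (simp add: nonempty_def)
  obtain k where k: "k \<ge> 1" "shift k ?y = ?y" using per by (auto simp: periodic_def)
  have "\<not> inj_on (\<lambda>i. start (\<sigma> \<circ> x) i mod k) {0..k}"
  proof
    assume "inj_on (\<lambda>i. start (\<sigma> \<circ> x) i mod k) {0..k}"
    moreover have "(\<lambda>i. start (\<sigma> \<circ> x) i mod k) ` {0..k} \<subseteq> {0..<k}" using k by auto
    ultimately have "card {0..k} \<le> card {0..<k}" by (rule card_inj_on_le) simp
    then show False using k by simp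
  qed
  then obtain i j where ij: "i < j" "start (\<sigma> \<circ> x) i mod k = start (\<sigma> \<circ> x) j mod k"
    unfolding inj_on_def by (metis linorder_less_linear)
  then obtain q where q: "start (\<sigma> \<circ> x) j = start (\<sigma> \<circ> x) i + k * q"
    by (metis mod_eqE add_diff_cancel_left' diff_add_cancel mod_eq_dvd_iff dvdE add.commute)
  have "shift i x = shift j x"
  proof (rule elementary_injective[OF fin \<sigma> elem])
    show "cat (\<sigma> \<circ> shift i x) = cat (\<sigma> \<circ> shift j x)"
      using shift_multiple[OF k(2), of q] by (simp add: comp_shift cat_shift[OF ne] q flip: shift_shift)
  qed (use S in auto)
  then have "shift (- i) (shift i x) = shift (- i) (shift j x)" by simp
  then have "shift (j - i) x = x" by simp
  then show ?thesis using ij(1) unfolding periodic_def by (intro exI[of _ "j - i"]) simp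
qed

section \<open>Desubstitution and factorization through a smaller alphabet\<close>

text \<open>The only property of \<open>subst_shift_space\<close> used in the induction. Since
  \<open>x'\<close> lies in \<open>Y\<close> again, desubstitution can be repeated, and the property
  passes to the conjugate morphism with the image of \<open>Y\<close> under
  \<open>\<beta>\<close>.\<close>

definition desubstitutable :: "('a \<Rightarrow> 'a list) \<Rightarrow> 'a set \<Rightarrow> (int \<Rightarrow> 'a) set \<Rightarrow> bool" where
  "desubstitutable \<sigma> S Y \<longleftrightarrow>
     (\<forall>x\<in>Y. range x \<subseteq> S \<and> (\<exists>x'\<in>Y. \<exists>k. x = shift k (cat (\<sigma> \<circ> x'))))"

lemma desubstitutableE:
  assumes "desubstitutable \<sigma> S Y" "x \<in> Y"
  obtains x' k where "x' \<in> Y" "x = shift k (cat (\<sigma> \<circ> x'))"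
  using assms unfolding desubstitutable_def by blast

text \<open>One reduction step: \<open>\<sigma>\<close> on \<open>S\<close> gives way to
  \<open>conjugate\<close>, that is \<beta>\<alpha>, on \<open>C\<close>.\<close>

locale factorization =
  fixes \<sigma> \<alpha> \<beta> :: "'a \<Rightarrow> 'a list" and S C :: "'a set"
  assumes \<sigma>_ne: "\<sigma> a \<noteq> []" and \<alpha>_ne: "\<alpha> a \<noteq> []" and \<beta>_ne: "\<beta> a \<noteq> []"
    and \<beta>_in: "a \<in> S \<Longrightarrow> set (\<beta> a) \<subseteq> C" and \<alpha>_in: "c \<in> C \<Longrightarrow> set (\<alpha> c) \<subseteq> S"
    and \<sigma>_eq: "a \<in> S \<Longrightarrow> concat (map \<alpha> (\<beta> a)) = \<sigma> a"
begin

definition conjugate :: "'a \<Rightarrow> 'a list" where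
  "conjugate c = concat (map \<beta> (\<alpha> c))"

lemma ne [simp]: "nonempty (\<sigma> \<circ> u)" "nonempty (\<alpha> \<circ> u)" "nonempty (\<beta> \<circ> u)"
  using \<sigma>_ne \<alpha>_ne \<beta>_ne by (simp_all add: nonempty_def)

lemma conjugate_ne: "conjugate c \<noteq> []"
  using \<alpha>_ne[of c] \<beta>_ne by (cases "\<alpha> c") (auto simp: conjugate_def)

lemma conjugate_in: "c \<in> C \<Longrightarrow> set (conjugate c) \<subseteq> C"
  using \<alpha>_in \<beta>_in by (fastforce simp: conjugate_def)

lemma
  assumes "range u \<subseteq> S"
  shows cat_\<sigma>: "cat (\<sigma> \<circ> u) = cat (\<alpha> \<circ> cat (\<beta> \<circ> u))"
    and start_\<sigma>: "start (\<sigma> \<circ> u) n = start (\<alpha> \<circ> cat (\<beta> \<circ> u)) (start (\<beta> \<circ> u) n)"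
proof -
  have "(\<lambda>n. concat (map \<alpha> ((\<beta> \<circ> u) n))) = \<sigma> \<circ> u"
    using \<sigma>_eq assms by (auto simp: fun_eq_iff)
  with cat_concat[OF ne(3) ne(2), of u] show
    "cat (\<sigma> \<circ> u) = cat (\<alpha> \<circ> cat (\<beta> \<circ> u))"
    "start (\<sigma> \<circ> u) n = start (\<alpha> \<circ> cat (\<beta> \<circ> u)) (start (\<beta> \<circ> u) n)" by metis+
qed

lemma cat_conjugate: "cat (conjugate \<circ> z) = cat (\<beta> \<circ> cat (\<alpha> \<circ> z))"
  and start_conjugate: "start (conjugate \<circ> z) n = start (\<beta> \<circ> cat (\<alpha> \<circ> z)) (start (\<alpha> \<circ> z) n)"
proof -
  have "(\<lambda>n. concat (map \<beta> ((\<alpha> \<circ> z) n))) = conjugate \<circ> z"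
    by (simp add: fun_eq_iff conjugate_def)
  with cat_concat[OF ne(2) ne(3), of z] show
    "cat (conjugate \<circ> z) = cat (\<beta> \<circ> cat (\<alpha> \<circ> z))"
    "start (conjugate \<circ> z) n = start (\<beta> \<circ> cat (\<alpha> \<circ> z)) (start (\<alpha> \<circ> z) n)" by metis+
qed

lemma cat_\<beta>_shift: "cat (\<beta> \<circ> shift k y) = shift (start (\<beta> \<circ> y) k) (cat (\<beta> \<circ> y))"
  by (simp add: comp_shift cat_shift)

text \<open>\<beta>(\<alpha>\<beta>) = (\<beta>\<alpha>)\<beta>, so \<beta> intertwines \<sigma>
  with its conjugate.\<close>

lemma cat_\<beta>_cat_\<sigma>:
  "range u \<subseteq> S \<Longrightarrow> cat (\<beta> \<circ> cat (\<sigma> \<circ> u)) = cat (conjugate \<circ> cat (\<beta> \<circ> u))"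
  by (simp add: cat_\<sigma> cat_conjugate)

lemma periodic_\<alpha>: "periodic z \<Longrightarrow> periodic (cat (\<alpha> \<circ> z))"
  and periodic_\<beta>: "periodic z \<Longrightarrow> periodic (cat (\<beta> \<circ> z))"
  by (simp_all add: periodic_cat periodic_comp)

lemma desubstitutable_conjugate:
  assumes "desubstitutable \<sigma> S Y"
  shows "desubstitutable conjugate C ((\<lambda>x. cat (\<beta> \<circ> x)) ` Y)"
  unfolding desubstitutable_def
proof (intro ballI conjI)
  fix z
  assume "z \<in> (\<lambda>x. cat (\<beta> \<circ> x)) ` Y"
  then obtain x where x: "x \<in> Y" "z = cat (\<beta> \<circ> x)" by blast
  have S: "range u \<subseteq> S" if "u \<in> Y" for u using assms that by (simp add: desubstitutable_def)
  have "set ((\<beta> \<circ> x) n) \<subseteq> C" for n using S[OF x(1)] \<beta>_in[of "x n"] by auto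
  then show "range z \<subseteq> C" unfolding x(2) by (rule range_cat[OF ne(3)])
  obtain x' k where x': "x' \<in> Y" "x = shift k (cat (\<sigma> \<circ> x'))"
    using desubstitutableE[OF assms x(1)] .
  have "z = shift (start (\<beta> \<circ> cat (\<sigma> \<circ> x')) k) (cat (conjugate \<circ> cat (\<beta> \<circ> x')))"
    using x' x(2) S by (simp add: cat_\<beta>_shift cat_\<beta>_cat_\<sigma>)
  with x'(1) show "\<exists>z'\<in>(\<lambda>x. cat (\<beta> \<circ> x)) ` Y. \<exists>k. z = shift k (cat (conjugate \<circ> z'))" by blast
qed

text \<open>The assumption is used twice. It first makes \<beta>(x) periodic; as x is a shift of
  \<sigma>(x'), \<beta>(x) is a shift of (\<beta>\<alpha>)(\<beta>(x')), so \<beta>(x') is periodic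
  too. Applying \<alpha> to it gives \<sigma>(x'), hence x.\<close>

lemma reflects_periodic_from_conjugate:
  assumes Y: "desubstitutable \<sigma> S Y"
    and reflects: "\<And>x. x \<in> Y \<Longrightarrow> periodic (cat (conjugate \<circ> cat (\<beta> \<circ> x))) \<Longrightarrow> periodic (cat (\<beta> \<circ> x))"
    and x: "x \<in> Y" and per: "periodic (cat (\<sigma> \<circ> x))"
  shows "periodic x"
proof -
  have S: "range u \<subseteq> S" if "u \<in> Y" for u using Y that by (simp add: desubstitutable_def)
  obtain x' k where x': "x' \<in> Y" "x = shift k (cat (\<sigma> \<circ> x'))"
    using desubstitutableE[OF Y x] .
  have "periodic (cat (conjugate \<circ> cat (\<beta> \<circ> x)))"
    using periodic_\<beta>[OF per] cat_\<beta>_cat_\<sigma>[OF S[OF x]] by simp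
  then have "periodic (cat (\<beta> \<circ> x))" by (rule reflects[OF x])
  then have "periodic (cat (conjugate \<circ> cat (\<beta> \<circ> x')))"
    using x' S by (simp add: cat_\<beta>_shift cat_\<beta>_cat_\<sigma>)
  then have "periodic (cat (\<beta> \<circ> x'))" by (rule reflects[OF x'(1)])
  then show ?thesis using periodic_\<alpha> cat_\<sigma>[OF S[OF x'(1)]] x'(2) by simp
qed

text \<open>Recognizability of \<beta>\<alpha> at z = \<beta>(x) shows that z' is z shifted by some
  m. It remains to see that m is a cut of the factorization of z by \<beta>. For this x and x' are
  desubstituted once and recognizability is used again at w = \<beta>(u).\<close>

lemma recognizable_from_conjugate:
  assumes Y: "desubstitutable \<sigma> S Y"
    and rec: "\<And>x x' k. x \<in> Y \<Longrightarrow> x' \<in> Y \<Longrightarrow>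
      cat (conjugate \<circ> cat (\<beta> \<circ> x')) = shift k (cat (conjugate \<circ> cat (\<beta> \<circ> x))) \<Longrightarrow>
      aperiodic (cat (conjugate \<circ> cat (\<beta> \<circ> x))) \<Longrightarrow>
      \<exists>p. cat (\<beta> \<circ> x') = shift p (cat (\<beta> \<circ> x)) \<and> k = start (conjugate \<circ> cat (\<beta> \<circ> x)) p"
    and reflects: "periodic (cat (\<sigma> \<circ> cat (\<sigma> \<circ> x))) \<Longrightarrow> periodic (cat (\<sigma> \<circ> x))"
    and x: "x \<in> Y" "x' \<in> Y"
    and eq: "cat (\<sigma> \<circ> x') = shift k (cat (\<sigma> \<circ> x))" and aper: "aperiodic (cat (\<sigma> \<circ> x))"
  shows "\<exists>p. x' = shift p x \<and> k = start (\<sigma> \<circ> x) p"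
proof -
  have S: "range u \<subseteq> S" if "u \<in> Y" for u using Y that by (simp add: desubstitutable_def)
  define z z' where "z = cat (\<beta> \<circ> x)" and "z' = cat (\<beta> \<circ> x')"
  have \<sigma>z: "cat (\<sigma> \<circ> x) = cat (\<alpha> \<circ> z)" "cat (\<sigma> \<circ> x') = cat (\<alpha> \<circ> z')"
    using cat_\<sigma> S x by (simp_all add: z_def z'_def)
  \<comment> \<open>Applying \<alpha> to (\<beta>\<alpha>)(z) = \<beta>(\<sigma>(x)) gives
    \<sigma>(\<sigma>(x)), so \<open>reflects\<close> would make \<sigma>(x) periodic.\<close>
  have "aperiodic (cat (conjugate \<circ> z))"
  proof
    assume "periodic (cat (conjugate \<circ> z))"
    from periodic_\<alpha>[OF this] have "periodic (cat (\<alpha> \<circ> cat (\<beta> \<circ> cat (\<sigma> \<circ> x))))"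
      by (simp add: cat_conjugate \<sigma>z)
    moreover have "range (cat (\<sigma> \<circ> x)) \<subseteq> S"
    proof (rule range_cat[OF ne(1)])
      fix n
      have "x n \<in> S" using S x by blast
      then show "set ((\<sigma> \<circ> x) n) \<subseteq> S"
        using \<alpha>_in \<beta>_in by (fastforce simp flip: \<sigma>_eq)
    qed
    ultimately show False using reflects aper by (simp add: cat_\<sigma>[of "cat (\<sigma> \<circ> x)"])
  qed
  moreover have "cat (conjugate \<circ> z') = shift (start (\<beta> \<circ> cat (\<alpha> \<circ> z)) k) (cat (conjugate \<circ> z))"
    using eq by (simp add: cat_conjugate \<sigma>z cat_\<beta>_shift)
  ultimately obtain m where m: "z' = shift m z" "start (\<beta> \<circ> cat (\<alpha> \<circ> z)) k = start (conjugate \<circ> z) m"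
    using rec[OF x] unfolding z_def z'_def by blast
  \<comment> \<open>Distinct indices have distinct starts, so the outer \<open>start\<close> for
    \<beta> can be cancelled.\<close>
  from m(2) have k: "k = start (\<alpha> \<circ> z) m"
    by (simp add: start_conjugate start_eq_iff)
  obtain u i where u: "u \<in> Y" "x = shift i (cat (\<sigma> \<circ> u))"
    using desubstitutableE[OF Y x(1)] .
  obtain u' j where u': "u' \<in> Y" "x' = shift j (cat (\<sigma> \<circ> u'))"
    using desubstitutableE[OF Y x(2)] .
  define w w' where "w = cat (\<beta> \<circ> u)" and "w' = cat (\<beta> \<circ> u')"
  have xw: "x = shift i (cat (\<alpha> \<circ> w))" "x' = shift j (cat (\<alpha> \<circ> w'))"
    using cat_\<sigma> S u u' by (simp_all add: w_def w'_def)
  \<comment> \<open>These count positions after \<beta> is applied to \<alpha>(w) and \<alpha>(w');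
    they turn the shifts \<open>i\<close> and \<open>j\<close> into shifts of (\<beta>\<alpha>)(w)
    and (\<beta>\<alpha>)(w').\<close>
  define b b' where "b = start (\<beta> \<circ> cat (\<alpha> \<circ> w))" and "b' = start (\<beta> \<circ> cat (\<alpha> \<circ> w'))"
  have z: "z = shift (b i) (cat (conjugate \<circ> w))" "z' = shift (b' j) (cat (conjugate \<circ> w'))"
    by (simp_all add: z_def z'_def xw cat_\<beta>_shift cat_conjugate b_def b'_def)
  have "shift (- b' j) z' = shift (- b' j) (shift m z)" using m(1) by simp
  then have "cat (conjugate \<circ> w') = shift (m + b i - b' j) (cat (conjugate \<circ> w))"
    by (simp add: z algebra_simps)
  moreover have "aperiodic (cat (conjugate \<circ> w))"
    using aper periodic_\<alpha>[of z] by (auto simp: \<sigma>z z)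
  ultimately obtain p where p: "w' = shift p w" "m + b i - b' j = start (conjugate \<circ> w) p"
    using rec[OF u(1) u'(1)] unfolding w_def w'_def by blast
  define g where "g = start (\<alpha> \<circ> w) p"
  have \<alpha>w': "cat (\<alpha> \<circ> w') = shift g (cat (\<alpha> \<circ> w))"
    by (simp add: p(1) comp_shift cat_shift g_def)
  have b': "b' n = b (n + g) - b g" for n
    by (simp add: b'_def b_def \<alpha>w' comp_shift start_shift)
  have "start (\<beta> \<circ> x) (j + g - i) = b (j + g) - b i"
    by (simp add: xw comp_shift start_shift b_def)
  moreover have "m + b i - b' j = b g" using p(2) by (simp add: start_conjugate b_def g_def)
  \<comment> \<open>Here m = b g + b' j - b i = b (j + g) - b i, a difference of two \<beta>-cuts of
    \<alpha>(w), hence a \<beta>-cut relative to the origin of x.\<close>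
  ultimately have "m = start (\<beta> \<circ> x) (j + g - i)" using b' by simp
  then have "k = start (\<sigma> \<circ> x) (j + g - i)"
    using k start_\<sigma>[OF S[OF x(1)]] by (simp add: z_def)
  moreover have "x' = shift (j + g - i) x" by (simp add: xw(2) \<alpha>w') (simp add: xw(1))
  ultimately show ?thesis by blast
qed

end

lemma reducibleE:
  assumes "reducible \<sigma> S" "\<And>a. \<sigma> a \<noteq> []"
  obtains C \<alpha> \<beta> where "factorization \<sigma> \<alpha> \<beta> S C" "finite C" "card C < card S"
proof -
  obtain C \<alpha> \<beta> where "finite C" "card C < card S" "\<forall>a. \<alpha> a \<noteq> [] \<and> \<beta> a \<noteq> []"
    "\<forall>a\<in>S. set (\<beta> a) \<subseteq> C \<and> concat (map \<alpha> (\<beta> a)) = \<sigma> a" "\<forall>c\<in>C. set (\<alpha> c) \<subseteq> S"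
    using assms(1) unfolding reducible_def by blast
  moreover from this assms(2) have "factorization \<sigma> \<alpha> \<beta> S C" by unfold_locales auto
  ultimately show ?thesis using that by blast
qed

section \<open>Induction on the size of the alphabet\<close>

text \<open>\<open>\<sigma>\<close>, \<open>S\<close> and \<open>Y\<close> vary in the induction: in
  the reducible case they become the conjugate, the smaller alphabet \<open>C\<close> and the image
  of \<open>Y\<close> under \<open>\<beta>\<close>.\<close>

lemma desubstitutable_reflects_periodic:
  assumes "finite S" "\<And>a. \<sigma> a \<noteq> []" "\<And>a. a \<in> S \<Longrightarrow> set (\<sigma> a) \<subseteq> S" "desubstitutable \<sigma> S Y"
    and "x \<in> Y" "periodic (cat (\<sigma> \<circ> x))"
  shows "periodic x"
  using assms
proof (induction "card S" arbitrary: S \<sigma> Y x rule: less_induct)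
  case less
  have S: "range x \<subseteq> S" using less.prems(4,5) by (simp add: desubstitutable_def)
  show ?case
  proof (cases "reducible \<sigma> S")
    case True
    obtain C \<alpha> \<beta> where "factorization \<sigma> \<alpha> \<beta> S C" and C: "finite C" "card C < card S"
      using reducibleE[OF True less.prems(2)] .
    then interpret factorization \<sigma> \<alpha> \<beta> S C by simp
    show ?thesis
    proof (rule reflects_periodic_from_conjugate[OF less.prems(4) _ less.prems(5,6)])
      fix u
      assume "u \<in> Y" "periodic (cat (conjugate \<circ> cat (\<beta> \<circ> u)))"
      then show "periodic (cat (\<beta> \<circ> u))"
        using less.hyps[OF C(2,1) conjugate_ne conjugate_in desubstitutable_conjugate[OF less.prems(4)]]
        by blast
    qed
  next
    case False
    show ?thesis by (rule elementary_reflects_periodic[OF less.prems(1-3) False S less.prems(6)])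
  qed
qed

lemma desubstitutable_recognizable:
  assumes "finite S" "\<And>a. \<sigma> a \<noteq> []" "\<And>a. a \<in> S \<Longrightarrow> set (\<sigma> a) \<subseteq> S" "desubstitutable \<sigma> S Y"
    and "x \<in> Y" "x' \<in> Y" "cat (\<sigma> \<circ> x') = shift k (cat (\<sigma> \<circ> x))" "aperiodic (cat (\<sigma> \<circ> x))"
  shows "\<exists>p. x' = shift p x \<and> k = start (\<sigma> \<circ> x) p"
  using assms
proof (induction "card S" arbitrary: S \<sigma> Y x x' k rule: less_induct)
  case less
  have S: "range u \<subseteq> S" if "u \<in> Y" for u using less.prems(4) that by (simp add: desubstitutable_def)
  show ?case
  proof (cases "reducible \<sigma> S")
    case True
    obtain C \<alpha> \<beta> where "factorization \<sigma> \<alpha> \<beta> S C" and C: "finite C" "card C < card S"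
      using reducibleE[OF True less.prems(2)] .
    then interpret factorization \<sigma> \<alpha> \<beta> S C by simp
    show ?thesis
    proof (rule recognizable_from_conjugate[OF less.prems(4) _ _ less.prems(5-8)])
      fix u u' l
      assume "u \<in> Y" "u' \<in> Y"
        "cat (conjugate \<circ> cat (\<beta> \<circ> u')) = shift l (cat (conjugate \<circ> cat (\<beta> \<circ> u)))"
        "aperiodic (cat (conjugate \<circ> cat (\<beta> \<circ> u)))"
      then show "\<exists>p. cat (\<beta> \<circ> u') = shift p (cat (\<beta> \<circ> u)) \<and> l = start (conjugate \<circ> cat (\<beta> \<circ> u)) p"
        using less.hyps[OF C(2,1) conjugate_ne conjugate_in desubstitutable_conjugate[OF less.prems(4)]]
        by blast
    next
      \<comment> \<open>\<open>\<sigma>(x)\<close> need not belong to \<open>Y\<close>. Adding it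
        keeps the set desubstitutable, since \<open>x\<close> is in \<open>Y\<close>, and lets
        periodicity be reflected from \<open>\<sigma>(\<sigma>(x))\<close> to
        \<open>\<sigma>(x)\<close>.\<close>
      let ?Y = "insert (cat (\<sigma> \<circ> x)) Y"
      have "range (cat (\<sigma> \<circ> x)) \<subseteq> S"
      proof (rule range_cat[OF ne(1)])
        show "set ((\<sigma> \<circ> x) n) \<subseteq> S" for n using less.prems(3) S[OF less.prems(5)] by auto
      qed
      moreover have "\<exists>k. cat (\<sigma> \<circ> x) = shift k (cat (\<sigma> \<circ> x))" by (rule exI[of _ 0]) simp
      ultimately have "desubstitutable \<sigma> S ?Y"
        using less.prems(4,5) unfolding desubstitutable_def by blast
      then show "periodic (cat (\<sigma> \<circ> x))" if "periodic (cat (\<sigma> \<circ> cat (\<sigma> \<circ> x)))"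
        using desubstitutable_reflects_periodic[OF less.prems(1-3) _ _ that] by blast
    qed
  next
    case False
    show ?thesis
      by (rule elementary_recognizable[OF less.prems(1-3) False
            S[OF less.prems(5)] S[OF less.prems(6)] less.prems(7,8)])
  qed
qed

section \<open>Desubstitution in the substitution shift\<close>

text \<open>Compactness by nested infinite index sets: the sequences indexed by \<open>B r\<close>
  agree on the window of radius \<open>r\<close>. Infinitely many indices are kept for every
  \<open>r\<close>, so arbitrarily large ones can be chosen later.\<close>

lemma infinite_agreement:
  fixes X :: "nat \<Rightarrow> int \<Rightarrow> 'a::finite"
  assumes "infinite A"
  obtains x where "\<And>r. infinite {n \<in> A. \<forall>i. \<bar>i\<bar> \<le> int r \<longrightarrow> X n i = x i}"
proof -
  define P where "P r B \<longleftrightarrow> infinite B \<and> B \<subseteq> A \<and>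
    (\<forall>n\<in>B. \<forall>n'\<in>B. \<forall>i. \<bar>i\<bar> \<le> int r \<longrightarrow> X n i = X n' i)" for r B
  have refine: "\<exists>B'. P r B' \<and> B' \<subseteq> B" if B: "infinite B" "B \<subseteq> A" for r B
  proof -
    let ?f = "\<lambda>n. map (X n) [- int r..int r]"
    have "?f ` B \<subseteq> {xs. set xs \<subseteq> UNIV \<and> length xs = nat (2 * int r + 1)}" by auto
    then have "finite (?f ` B)" by (rule finite_subset) (rule finite_lists_length_eq, simp)
    from pigeonhole_infinite[OF B(1) this]
    obtain n0 where n0: "infinite {n \<in> B. ?f n = ?f n0}" by blast
    define B' where "B' = {n \<in> B. ?f n = ?f n0}"
    have "X n i = X n0 i" if "n \<in> B'" "\<bar>i\<bar> \<le> int r" for n i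
    proof -
      have "i \<in> set [- int r..int r]" using that(2) by auto
      moreover have "?f n = ?f n0" using that(1) by (simp add: B'_def)
      ultimately show ?thesis unfolding map_eq_conv by blast
    qed
    moreover have "infinite B'" "B' \<subseteq> B" using n0 by (auto simp: B'_def)
    ultimately have "P r B' \<and> B' \<subseteq> B" unfolding P_def using B(2) by auto
    then show ?thesis ..
  qed
  have "\<exists>B. \<forall>r. P r (B r) \<and> B (Suc r) \<subseteq> B r"
  proof (rule dependent_nat_choice)
    show "\<exists>B. P 0 B" using refine[OF assms subset_refl] by blast
    show "\<exists>B'. P (Suc r) B' \<and> B' \<subseteq> B" if "P r B" for B r
      using refine[of B "Suc r"] that by (simp add: P_def)
  qed
  then obtain B where B: "\<And>r. P r (B r)" "\<And>r. B (Suc r) \<subseteq> B r" by blast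
  have anti: "B r \<subseteq> B s" if "s \<le> r" for r s
    using that by (induction rule: dec_induct) (use B(2) in blast)+
  \<comment> \<open>Any index in \<open>B (nat \<bar>i\<bar>)\<close> gives the same letter at
    \<open>i\<close>.\<close>
  define x where "x i = X (SOME n. n \<in> B (nat \<bar>i\<bar>)) i" for i
  have agree: "X n i = x i" if "n \<in> B r" "\<bar>i\<bar> \<le> int r" for n i r
  proof -
    have "nat \<bar>i\<bar> \<le> r" using that(2) by simp
    from anti[OF this] that(1) have "n \<in> B (nat \<bar>i\<bar>)" by blast
    moreover from this have "(SOME n. n \<in> B (nat \<bar>i\<bar>)) \<in> B (nat \<bar>i\<bar>)" by (rule someI)
    moreover from B(1)[of "nat \<bar>i\<bar>"] have "\<forall>n\<in>B (nat \<bar>i\<bar>). \<forall>n'\<in>B (nat \<bar>i\<bar>).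
        \<forall>i'. \<bar>i'\<bar> \<le> int (nat \<bar>i\<bar>) \<longrightarrow> X n i' = X n' i'" unfolding P_def by blast
    ultimately have "\<bar>i\<bar> \<le> int (nat \<bar>i\<bar>) \<longrightarrow> X n i = X (SOME n. n \<in> B (nat \<bar>i\<bar>)) i" by blast
    then show ?thesis unfolding x_def by simp
  qed
  show ?thesis
  proof (rule that)
    fix r
    have "B r \<subseteq> {n \<in> A. \<forall>i. \<bar>i\<bar> \<le> int r \<longrightarrow> X n i = x i}"
      using B(1)[of r] agree by (auto simp: P_def)
    then show "infinite {n \<in> A. \<forall>i. \<bar>i\<bar> \<le> int r \<longrightarrow> X n i = x i}"
      using B(1)[of r] infinite_super by (auto simp: P_def)
  qed
qed

lemma start_diff_le:
  assumes "\<And>n. length (w n) \<le> L" "m \<le> n"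
  shows "start w n - start w m \<le> int L * (n - m)"
  using assms(2)
proof (induction n rule: int_ge_induct)
  case (step n)
  then show ?case using assms(1)[of n] start_Suc[of w n] by (simp add: algebra_simps)
qed simp

text \<open>As blocks are non-empty, the block covering \<open>t\<close> has an index of absolute
  value at most that of \<open>t\<close>, and its start depends only on blocks between it and
  0.\<close>

lemma cat_local:
  assumes "nonempty w" "nonempty w'" "\<And>i. \<bar>i\<bar> \<le> \<bar>t\<bar> \<Longrightarrow> w i = w' i"
  shows "cat w t = cat w' t"
proof -
  obtain n i where ni: "t = start w n + int i" "i < length (w n)" using block_cases[OF assms(1)] .
  have n: "\<bar>n\<bar> \<le> \<bar>t\<bar>"
  proof (cases "0 \<le> n")
    case True
    then show ?thesis using start_mono[OF assms(1), of 0 n] ni by simp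
  next
    case False
    then show ?thesis using start_mono[OF assms(1), of "n + 1" 0] ni by (simp add: start_Suc)
  qed
  then have "start w n = start w' n" unfolding start_def using assms(3) by auto
  then show ?thesis
    using cat_block[OF assms(1) ni(2)] cat_block[OF assms(2), of i n] ni assms(3)[OF n] by simp
qed

lemma sublist_map_upto:
  assumes "a \<le> i" "j \<le> b"
  shows "sublist (map f [i..j]) (map f [a..b])"
proof (cases "i \<le> j")
  case True
  have "[a..b] = [a..i - 1] @ [i..j] @ [j + 1..b]"
    using assms True upto_split1[of a i b] upto_split2[of i j b] by simp
  then show ?thesis unfolding sublist_def by (metis map_append)
qed simp

lemma language_sublist: "sublist v w \<Longrightarrow> w \<in> language \<sigma> \<Longrightarrow> v \<in> language \<sigma>"
  unfolding language_def using sublist_order.order_trans by blast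

text \<open>A window of \<open>x\<close> lies in \<sigma>(v) for some v in the language. Recentering
  v at the block covering the middle of the window gives \<open>u\<close>; since blocks have length
  at most \<open>L\<close>, the \<open>r\<close> letters on either side stay inside v when
  \<open>L * r \<le> n\<close>. The bound \<open>k < L\<close> allows a pigeonhole choice of the
  offset.\<close>

lemma desubstitute_window:
  assumes \<sigma>: "\<And>a. \<sigma> a \<noteq> []" "\<And>a. length (\<sigma> a) \<le> L"
    and win: "map x [- int n..int n] \<in> language \<sigma>" and n: "n \<ge> 1"
  shows "\<exists>u k. k < L \<and> (\<forall>i. \<bar>i\<bar> \<le> int n \<longrightarrow> cat (\<sigma> \<circ> u) (int k + i) = x i) \<and>
    (\<forall>r. L * r \<le> n \<longrightarrow> map u [- int r..int r] \<in> language \<sigma>)"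
proof -
  obtain a N where aN: "sublist (map x [- int n..int n]) ((subst_word \<sigma> ^^ N) [a])"
    using win unfolding language_def by blast
  \<comment> \<open>The window has at least three letters, too many for a factor of
    \<open>[a]\<close>.\<close>
  have "N \<noteq> 0"
  proof
    assume "N = 0"
    then show False using sublist_length_le[OF aN] n by simp
  qed
  then obtain N' where N: "N = Suc N'" by (cases N) auto
  define v where "v = (subst_word \<sigma> ^^ N') [a]"
  have v: "v \<in> language \<sigma>" unfolding language_def v_def by blast
  obtain ps ss where ps: "concat (map \<sigma> v) = ps @ map x [- int n..int n] @ ss"
    using aN unfolding N sublist_def by (auto simp: v_def subst_word_def)
  \<comment> \<open>Padding by \<open>a\<close> makes \<open>v\<close> bi-infinite; the bounds on
    \<open>j\<close> below keep the relevant window inside \<open>v\<close>.\<close>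
  define u where "u i = (if 0 \<le> i \<and> i < int (length v) then v ! nat i else a)" for i
  have vu: "v = map u [0..int (length v) - 1]"
    by (rule nth_equalityI) (auto simp: u_def)
  have ne: "nonempty (\<sigma> \<circ> u)" using \<sigma>(1) by (simp add: nonempty_def)
  have u0: "u (0 + int i) = v ! i" if "i < length v" for i using that by (simp add: u_def)
  have len: "start (\<sigma> \<circ> u) (int (length v)) = int (length ps + (2 * n + 1) + length ss)"
    using cat_factor(1)[of \<sigma> u v 0, OF ne u0] ps by simp
  define c where "c = int (length ps + n)"
  have center: "cat (\<sigma> \<circ> u) (c + i) = x i" if i: "\<bar>i\<bar> \<le> int n" for i
  proof -
    define t where "t = length ps + nat (int n + i)"
    have t: "c + i = int t" using i by (simp add: t_def c_def)
    have "t < length (concat (map \<sigma> v))" using i by (simp add: ps t_def)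
    from cat_factor(2)[OF ne u0 this] have "cat (\<sigma> \<circ> u) (c + i) = concat (map \<sigma> v) ! t"
      unfolding t by simp
    moreover have "0 \<le> int n + i" "i \<le> int n" using i by linarith+
    ultimately show ?thesis by (simp add: ps t_def nth_append)
  qed
  obtain j k where jk: "c = start (\<sigma> \<circ> u) j + int k" "k < length ((\<sigma> \<circ> u) j)"
    using block_cases[OF ne] .
  have L: "length ((\<sigma> \<circ> u) n) \<le> L" for n using \<sigma>(2) by simp
  show ?thesis
  proof (intro exI conjI allI impI)
    show "k < L" using jk(2) L[of j] by linarith
    show "cat (\<sigma> \<circ> shift j u) (int k + i) = x i" if "\<bar>i\<bar> \<le> int n" for i
      using center[OF that] jk(1) by (simp add: comp_shift cat_shift[OF ne] shift_apply algebra_simps)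
    fix r
    assume r: "L * r \<le> n"
    then have r': "int L * int r \<le> int n" by (metis of_nat_le_iff of_nat_mult)
    \<comment> \<open>The centre \<open>c\<close> is at least \<open>n\<close> positions from the
      left end of \<sigma>(v) and more than \<open>n\<close> from its right end, while
      \<open>r\<close> blocks cover at most \<open>n\<close> positions. This bounds \<open>j\<close>
      here, and \<open>j + int r\<close> below.\<close>
    have "int r \<le> j"
    proof (rule ccontr)
      assume "\<not> int r \<le> j"
      then have "j + 1 \<le> int r" by simp
      have "c < start (\<sigma> \<circ> u) (j + 1)" using jk by (simp add: start_Suc)
      also have "\<dots> \<le> start (\<sigma> \<circ> u) (int r)"
        using start_mono[OF ne \<open>j + 1 \<le> int r\<close>] \<open>j + 1 \<le> int r\<close> by simp
      also have "\<dots> \<le> int L * int r" using start_diff_le[where w = "\<sigma> \<circ> u", OF L, of 0 "int r"] by simp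
      finally show False using r' by (simp add: c_def)
    qed
    moreover have "j + int r < int (length v)"
    proof (rule ccontr)
      assume "\<not> j + int r < int (length v)"
      then have le: "int (length v) \<le> j + int r" by simp
      have "c + int n < start (\<sigma> \<circ> u) (int (length v))" by (simp add: len c_def)
      also have "\<dots> \<le> start (\<sigma> \<circ> u) (j + int r)" using start_mono[OF ne le] le by simp
      also have "\<dots> \<le> start (\<sigma> \<circ> u) j + int L * int r"
        using start_diff_le[where w = "\<sigma> \<circ> u", OF L, of j "j + int r"] by simp
      finally show False using r' jk by simp
    qed
    ultimately have "sublist (map u [j - int r..j + int r]) v"
      using sublist_map_upto[of 0 "j - int r" "j + int r" "int (length v) - 1" u] vu by simp
    moreover have "map (shift j u) [- int r..int r] = map u [j - int r..j + int r]"
      by (rule nth_equalityI) (auto simp: shift_apply algebra_simps)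
    ultimately show "map (shift j u) [- int r..int r] \<in> language \<sigma>"
      using language_sublist v by metis
  qed
qed

text \<open>Windows of growing size are desubstituted. Infinitely many share one offset, and a limit
  of their preimages is \<open>x'\<close>. Membership in the shift space and equality of each letter
  involve finite windows only, so both pass to the limit.\<close>

lemma desubstitutable_subst_shift_space:
  fixes \<sigma> :: "'a::finite \<Rightarrow> 'a list"
  assumes \<sigma>: "\<And>a. \<sigma> a \<noteq> []"
  shows "desubstitutable \<sigma> UNIV (subst_shift_space \<sigma>)"
  unfolding desubstitutable_def
proof (intro ballI conjI subset_UNIV)
  fix x
  assume x: "x \<in> subst_shift_space \<sigma>"
  define L where "L = Max (range (\<lambda>a. length (\<sigma> a)))"
  have L: "length (\<sigma> a) \<le> L" for a by (simp add: L_def)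
  have ne: "nonempty (\<sigma> \<circ> u)" for u using \<sigma> by (simp add: nonempty_def)
  have "\<exists>u k. k < L \<and> (\<forall>i. \<bar>i\<bar> \<le> int (Suc n) \<longrightarrow> cat (\<sigma> \<circ> u) (int k + i) = x i) \<and>
    (\<forall>r. L * r \<le> Suc n \<longrightarrow> map u [- int r..int r] \<in> language \<sigma>)" for n
  proof (rule desubstitute_window[OF \<sigma> L])
    show "map x [- int (Suc n)..int (Suc n)] \<in> language \<sigma>"
      using x unfolding subst_shift_space_def by blast
  qed simp
  from choice[OF allI[OF this]] obtain X where
    "\<forall>n. \<exists>k. k < L \<and> (\<forall>i. \<bar>i\<bar> \<le> int (Suc n) \<longrightarrow> cat (\<sigma> \<circ> X n) (int k + i) = x i) \<and>
      (\<forall>r. L * r \<le> Suc n \<longrightarrow> map (X n) [- int r..int r] \<in> language \<sigma>)" ..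
  from choice[OF this] obtain K where K: "\<And>n. K n < L"
    and X: "\<And>n i. \<bar>i\<bar> \<le> int (Suc n) \<Longrightarrow> cat (\<sigma> \<circ> X n) (int (K n) + i) = x i"
    and lang: "\<And>n r. L * r \<le> Suc n \<Longrightarrow> map (X n) [- int r..int r] \<in> language \<sigma>"
    by blast
  have "finite (range K)" using K by (intro finite_subset[of "range K" "{..<L}"]) auto
  from pigeonhole_infinite[OF infinite_UNIV_nat this]
  obtain n0 where "infinite {n. K n = K n0}" by auto
  then obtain x' where x': "\<And>r. infinite {n \<in> {n. K n = K n0}. \<forall>i. \<bar>i\<bar> \<le> int r \<longrightarrow> X n i = x' i}"
    by (rule infinite_agreement[where X = X]) blast
  \<comment> \<open>An index with the right offset and agreement can be taken beyond any bound
    \<open>m\<close>, hence large enough for the language condition or for the window around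
    \<open>t\<close>.\<close>
  have pick: "\<exists>n\<ge>m. K n = K n0 \<and> (\<forall>i. \<bar>i\<bar> \<le> int r \<longrightarrow> X n i = x' i)" for m r
    using x'[of r] unfolding infinite_nat_iff_unbounded_le by blast
  have "x' \<in> subst_shift_space \<sigma>"
    unfolding subst_shift_space_def
  proof (intro CollectI allI)
    fix i j
    define r where "r = nat (max \<bar>i\<bar> \<bar>j\<bar>)"
    obtain n where n: "L * r \<le> n" "\<And>i. \<bar>i\<bar> \<le> int r \<Longrightarrow> X n i = x' i" using pick by blast
    have "map x' [- int r..int r] = map (X n) [- int r..int r]" using n(2) by auto
    then have "map x' [- int r..int r] \<in> language \<sigma>"
      using lang[of r n] n(1) by (simp only: le_SucI)
    moreover have "sublist (map x' [i..j]) (map x' [- int r..int r])"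
      by (rule sublist_map_upto) (auto simp: r_def)
    ultimately show "map x' [i..j] \<in> language \<sigma>" using language_sublist by blast
  qed
  moreover have "x = shift (int (K n0)) (cat (\<sigma> \<circ> x'))"
  proof
    fix t
    obtain n where n: "nat \<bar>t\<bar> \<le> n" "K n = K n0"
      "\<And>i. \<bar>i\<bar> \<le> int (nat \<bar>t + int (K n0)\<bar>) \<Longrightarrow> X n i = x' i" using pick by blast
    have "cat (\<sigma> \<circ> X n) (t + int (K n0)) = cat (\<sigma> \<circ> x') (t + int (K n0))"
      by (rule cat_local[OF ne ne]) (use n(3) in simp)
    moreover have "cat (\<sigma> \<circ> X n) (t + int (K n0)) = x t"
      using X[of t n] n(1,2) by (simp add: add.commute)
    ultimately show "x t = shift (int (K n0)) (cat (\<sigma> \<circ> x')) t" by (simp add: shift_apply)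
  qed
  ultimately show "\<exists>x'\<in>subst_shift_space \<sigma>. \<exists>k. x = shift k (cat (\<sigma> \<circ> x'))" by blast
qed

section \<open>Uniqueness of centered representations\<close>

theorem theorem5p3:
  fixes \<sigma> :: "'a::finite \<Rightarrow> 'a list"
  assumes "substitution \<sigma>"
  shows "recognizable_aperiodic \<sigma> (subst_shift_space \<sigma>)"
  unfolding recognizable_aperiodic_def
proof (intro allI impI Uniq_I)
  fix y :: "int \<Rightarrow> 'a" and r r'
  assume aper: "aperiodic y"
    and r: "representation \<sigma> y r \<and> centered \<sigma> r \<and> snd r \<in> subst_shift_space \<sigma>"
    and r': "representation \<sigma> y r' \<and> centered \<sigma> r' \<and> snd r' \<in> subst_shift_space \<sigma>"
  obtain k x k' x' where kx: "r = (k, x)" "r' = (k', x')" by fastforce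
  have \<sigma>: "\<sigma> a \<noteq> []" for a using assms by (simp add: substitution_def)
  have y: "y = shift k (cat (\<sigma> \<circ> x))" "y = shift k' (cat (\<sigma> \<circ> x'))"
    and c: "0 \<le> k" "k < int (length (\<sigma> (x 0)))" "0 \<le> k'" "k' < int (length (\<sigma> (x' 0)))"
    and X: "x \<in> subst_shift_space \<sigma>" "x' \<in> subst_shift_space \<sigma>"
    using r r' by (auto simp: kx representation_def centered_def subst_seq_eq_cat)
  have "shift (- k') (shift k' (cat (\<sigma> \<circ> x'))) = shift (- k') (shift k (cat (\<sigma> \<circ> x)))"
    using y by simp
  then have eq: "cat (\<sigma> \<circ> x') = shift (k - k') (cat (\<sigma> \<circ> x))" by simp
  have "aperiodic (cat (\<sigma> \<circ> x))" using aper y(1) by simp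
  from desubstitutable_recognizable[OF finite \<sigma> subset_UNIV
      desubstitutable_subst_shift_space[OF \<sigma>] X eq this]
  obtain p where p: "x' = shift p x" "k - k' = start (\<sigma> \<circ> x) p" by blast
  \<comment> \<open>Centering of the first representation puts \<open>k\<close> in block 0 of
    \<sigma>(x). Centering of the second puts \<open>k\<close>, which is \<open>k'\<close> plus the
    start of block \<open>p\<close>, in block \<open>p\<close>. Blocks are disjoint.\<close>
  have "p = 0"
  proof (rule start_between)
    show "nonempty (\<sigma> \<circ> x)" using \<sigma> by (simp add: nonempty_def)
    show "start (\<sigma> \<circ> x) 0 \<le> k" "k < start (\<sigma> \<circ> x) (0 + 1)"
      using c start_Suc[of "\<sigma> \<circ> x" 0] by simp_all
    show "start (\<sigma> \<circ> x) p \<le> k" "k < start (\<sigma> \<circ> x) (p + 1)"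
      using c p by (simp_all add: start_Suc shift_apply)
  qed
  with p show "r = r'" by (simp add: kx)
qed

end
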